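(* Let $p,q\in[1,\infty]$ satisfy $\nu:=1-\frac{d_0}{p}-\frac1q\ge0$. For any $\lambda\ge1$ and any Borel nonnegative $f(t,x)$, setting $$R_\lambda f(t,x):=E_{t,x}\int_0^\infty e^{-\lambda s}f(t+s,x_s)\,ds,$$ we have $$\|R_\lambda f\|_{L_{p,q}(\mathbb R^{d+1}_+)}\le N\lambda^{-1}\|f\|_{L_{p,q}(\mathbb R^{d+1}_+)},$$ where $N=N(\delta,d,\underline R,p,q,p_0,\bar b_\infty)$.
   Context: Notation. $d\ge2$; $B_R=\{x\in\mathbb R^d:|x|<R\}$, $C_{T,R}=[0,T)\times B_R$, $C_{T,R}(t,x)=(t,x)+C_{T,R}$, $C_R(t,x)=C_{R^2,R}(t,x)$, $C_R=C_R(0,0)$; $\mathbb R^{d+1}_+=[0,\infty)\times\mathbb R^d$. For $p,q\in[1,\infty]$, $Q\subset\mathbb R^{d+1}$: $\|f\|^q_{L_{p,q}(Q)}=\int_{\mathbb R}(\int_{\mathbb R^d}I_Q|f|^pdx)^{q/p}dt$ if $p\ge q$, $\|f\|^p_{L_{p,q}(Q)}=\int_{\mathbb R^d}(\int_{\mathbb R}I_Q|f|^qdt)^{p/q}dx$ if $p\le q$, with the natural interpretation if $p$ or $q$ is $\infty$. Parameters. $\delta\in(0,1)$; $p_0,q_0\in[1,\infty)$, $d/p_0+1/q_0=1$; $\mathbb S_\delta$ is the set of symmetric $d\times d$ matrices with eigenvalues in $[\delta,\delta^{-1}]$. $h\ge 0$ is a function on $\mathbb R^{d+1}$ and $\bar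 b_R$, $R\in(0,\infty)$, a bounded nondecreasing function with $\|h\|^{q_0}_{L_{p_0,q_0}(C_R(t,x))}\le\bar b_RR$ for all $(t,x)$, $R>0$; $\bar b_\infty=\lim_{R\to\infty}\bar b_R$. Diffusion-type processes. These are $x_t=\int_0^t\sigma_sdw_s+\int_0^tb_sds$ on a filtered complete probability space, $w_t$ a $d$-dimensional Wiener process, $\sigma_t$ adapted $\mathbb S_\delta$-valued, $b_t$ adapted with $\int_0^T|b_t|dt<\infty$ and $|b_t|\le h(t,x_t)$, for some such $h,\bar b$. For them $\tau_R(x)$ is the first exit time of $(t,x+x_t)$ from $C_R$, $\tau'_R(x)=\inf\{t\ge0:x+x_t\notin B_R\}$, $\gamma_R(x)=\inf\{t\ge0:x+x_t\in\bar B_R\}$. Constants from earlier work (fixed). $\bar\xi=\bar\xi(d,\delta)\in(0,1)$ and $\bar N=\bar N(d,p_0,\delta)$ (continuous in $\delta$) are such that for every diffusion-type process and every $R$ with $\bar N\bar b_R\le1$: $P(\tau_R(x)=R^2)\le1-\bar\xi$ ($|x|\le R$), $P(\tau_R(0)=R^2)\ge\bar\xi$, $P(\tau'_R(x)\ge nR^2)\le(1-\bar\xi)^n$ ($|x|\le R$, $n\ge1$), $P(\tau'_R(x)>\gamma_{R/16}(x))\ge\bar\xi$ ($|x|\le9R/16$). Standing assumption: $\underline R\in(0,\infty)$ satisfies $\bar N\bar b_{\underline R}<1$. $d_0\in(d/2,d)$ is the constant, depending only on $\delta,d,\underline R,p_0$, known to have the following properties for all diffusion-type processes with $\bar N\bar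 b_{\underline R}<1$. (i) For $\lambda>0$ let $G_\lambda\ge0$ be the Green's function: $E\int_0^\infty e^{-\lambda t}f(t,x_t)dt=\int_0^\infty\int_{\mathbb R^d}G_\lambda f\,dxdt$ for Borel $f\ge0$; then $\int_0^\infty\int_{\mathbb R^d}G_\lambda^{p/(p-1)}dxdt\le N(\delta,d,\underline R,p_0,\lambda,p)$ for $p\ge d_0+1$. (ii) If $p,q\in[1,\infty]$, $\nu=1-d_0/p-1/q\ge0$, then for $\lambda>0$ and Borel $f\ge0$, $E\int_0^\infty e^{-\lambda t}f(t,x_t)dt\le N\ddot\lambda^{-\nu+(d-2d_0)/(2p)}\|\Psi_\lambda^{1-\nu}f\|_{L_{p,q}(\mathbb R^{d+1}_+)}$ with $N=N(\delta,d,\underline R,p,q,p_0,\bar b_\infty)$, $\ddot\lambda=\lambda(1\wedge\lambda)^{d/(2d_0-d)}$, $\Psi_\lambda(t,x)=\exp(-\sqrt{\dot\lambda}(|x|+\sqrt t)\bar\xi/16)$, $\dot\lambda=\lambda\min(1,\lambda\underline R^2)$. (iii) If $\nu=0$, $\bar R\ge\underline R$, $R\in(0,\bar R]$, Borel $f\ge0$ on $C_R$: $E\int_0^{\tau_R(x)}f(t,x+x_t)dt\le NR^{(2d_0-d)/p}\|f\|_{L_{p,q}(C_R)}$ with $N=N(\delta,d,\underline R,p,p_0,\bar b_{\bar R},\bar R)$. Markov process. $\sigma(t,x)$, $b(t,x)$ are Borel on $\mathbb R^{d+1}$ with values in $\mathbb S_\delta$ and $\mathbb R^d$, $|b|\le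 h$. $\Omega$ is the set of continuous functions $\omega=\{(t_0+t,x_t),t\ge0\}$, $t_0\in\mathbb R$, with values in $\mathbb R^{d+1}$; $\mathsf t_t(\omega)=t_0+t$, $x_t(\omega)=x_t$, $\mathcal N_t=\sigma((\mathsf t_s,x_s),s\le t)$. $X=\{(\mathsf t_t,x_t),\infty,\mathcal N_t,P_{t,x}\}$ is a fixed strong Markov process on $\mathbb R^{d+1}$ with infinite lifetime (Dynkin's terminology; existence is known) such that $\{(\mathsf t_t,x_t),\infty,\mathcal N_{t+},P_{t,x}\}$ is Markov and for any $(t,x)$ there is a $d$-dimensional Wiener process $w$ relative to the $P_{t,x}$-completions of $\mathcal N_s$ such that $P_{t,x}$-a.s., for all $s\ge0$, $\mathsf t_s=t+s$ and $x_s=x+\int_0^s\sigma(t+r,x_r)dw_r+\int_0^sb(t+r,x_r)dr$. $E_{t,x}$ is expectation under $P_{t,x}$. A constant written $N(\dots)$ depends only on the listed quantities (it is the same for all processes with the same values of them). *)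

theory Defs
  imports "HOL-Probability.Probability"
begin

text \<open>Space-time is the product of the real line with \<open>real^'n\<close>, so the spatial dimension is
  \<open>CARD('n)\<close>. Processes are indexed by \<open>real\<close>; only times \<open>t \<ge> 0\<close> are meaningful.\<close>

type_synonym 'n spacetime = "real \<times> (real, 'n) vec"
type_synonym 'n trajectory = "real \<Rightarrow> 'n spacetime"


section \<open>Mixed norms\<close>

text \<open>Exponents in the range from 1 to infinity are extended nonnegative reals; \<open>rcp p\<close> is the real
  number 1/p, with 1/infinity = 0. The power \<open>epow\<close> is used for \<open>a > 0\<close> only.\<close>

definition rcp :: "ennreal \<Rightarrow> real" where
  "rcp p = enn2real (inverse p)"

definition epow :: "ennreal \<Rightarrow> real \<Rightarrow> ennreal" where
  "epow u a = (if u = \<infinity> then \<infinity> else ennreal (enn2real u powr a))"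

definition Lp_norm :: "'a measure \<Rightarrow> ennreal \<Rightarrow> ('a \<Rightarrow> ennreal) \<Rightarrow> ennreal" where
  "Lp_norm M p f =
     (if p = \<infinity> then esssup M f
      else epow (\<integral>\<^sup>+ y. epow (f y) (enn2real p) \<partial>M) (rcp p))"

text \<open>The exponent \<open>p\<close> belongs to the space variable and \<open>q\<close> to time; the larger exponent is always
  integrated first. For \<open>p = q\<close> the two orders agree on Borel functions.\<close>

definition mixed_norm ::
  "ennreal \<Rightarrow> ennreal \<Rightarrow> 'n::finite spacetime set \<Rightarrow> ('n spacetime \<Rightarrow> ennreal) \<Rightarrow> ennreal" where
  "mixed_norm p q Q f =
     (if q \<le> p
      then Lp_norm lborel q (\<lambda>t. Lp_norm lborel p (\<lambda>x. indicator Q (t, x) * f (t, x)))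
      else Lp_norm lborel p (\<lambda>x. Lp_norm lborel q (\<lambda>t. indicator Q (t, x) * f (t, x))))"

definition half_space :: "'n::finite spacetime set" where
  "half_space = {0..} \<times> UNIV"

text \<open>\<open>cylinder R (t, x)\<close> is \<open>C\<^sub>R(t,x)\<close>.\<close>

definition cylinder :: "real \<Rightarrow> 'n::finite spacetime \<Rightarrow> 'n spacetime set" where
  "cylinder R z = {fst z ..< fst z + R\<^sup>2} \<times> ball (snd z) R"

definition nu :: "real \<Rightarrow> ennreal \<Rightarrow> ennreal \<Rightarrow> real" where
  "nu d0 p q = 1 - d0 * rcp p - rcp q"


section \<open>The drift condition and uniform ellipticity\<close>

text \<open>Nonnegativity of \<open>bbar\<close> is implied by the norm bound in the mathematical text, but has to be
  stated because \<open>ennreal\<close> truncates negative reals to 0.\<close>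

definition drift_bound ::
  "real \<Rightarrow> real \<Rightarrow> ('n::finite spacetime \<Rightarrow> real) \<Rightarrow> (real \<Rightarrow> real) \<Rightarrow> bool" where
  "drift_bound p0 q0 h bbar \<longleftrightarrow>
     h \<in> borel_measurable borel \<and> (\<forall>z. 0 \<le> h z) \<and>
     bounded (bbar ` {0<..}) \<and> mono_on {0<..} bbar \<and> (\<forall>R>0. 0 \<le> bbar R) \<and>
     (\<forall>R>0. \<forall>z. epow (mixed_norm (ennreal p0) (ennreal q0) (cylinder R z) (\<lambda>y. ennreal (h y))) q0
                 \<le> ennreal (bbar R * R))"

definition admissible_exponents :: "'n::finite itself \<Rightarrow> real \<Rightarrow> real \<Rightarrow> bool" where
  "admissible_exponents _ p0 q0 \<longleftrightarrow> 1 \<le> p0 \<and> 1 \<le> q0 \<and> real CARD('n) / p0 + 1 / q0 = 1"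

definition S_delta :: "real \<Rightarrow> (real^'n::finite^'n) set" where
  "S_delta \<delta> = {A. transpose A = A \<and>
     (\<forall>c v. v \<noteq> 0 \<and> A *v v = c *\<^sub>R v \<longrightarrow> \<delta> \<le> c \<and> c \<le> 1 / \<delta>)}"


section \<open>Wiener processes and Ito integrals\<close>

text \<open>The library locale \<open>filtration\<close> involves all real times; requiring monotonicity also at
  negative times is no restriction.\<close>

definition complete_filtered_prob_space :: "'w measure \<Rightarrow> (real \<Rightarrow> 'w measure) \<Rightarrow> bool" where
  "complete_filtered_prob_space M F \<longleftrightarrow>
     prob_space M \<and> complete_measure M \<and> filtration (space M) F \<and> (\<forall>t. subalgebra M (F t)) \<and>
     (\<forall>t\<ge>0. null_sets M \<subseteq> sets (F t))"

definition adapted :: "(real \<Rightarrow> 'w measure) \<Rightarrow> (real \<Rightarrow> 'w \<Rightarrow> 'b::topological_space) \<Rightarrow> bool" where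
  "adapted F X \<longleftrightarrow> (\<forall>t\<ge>0. X t \<in> borel_measurable (F t))"

definition jointly_measurable :: "'w measure \<Rightarrow> (real \<Rightarrow> 'w \<Rightarrow> 'b::topological_space) \<Rightarrow> bool" where
  "jointly_measurable M X \<longleftrightarrow>
     (\<lambda>(t, \<omega>). X t \<omega>) \<in> borel_measurable (restrict_space borel {0..} \<Otimes>\<^sub>M M)"

definition wiener_process ::
  "'w measure \<Rightarrow> (real \<Rightarrow> 'w measure) \<Rightarrow> (real \<Rightarrow> 'w \<Rightarrow> real^'n::finite) \<Rightarrow> bool" where
  "wiener_process M F w \<longleftrightarrow>
     adapted F w \<and>
     (AE \<omega> in M. w 0 \<omega> = 0 \<and> continuous_on {0..} (\<lambda>t. w t \<omega>)) \<and>
     (\<forall>s\<ge>0. \<forall>t>s.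
        distributed M lborel (\<lambda>\<omega>. w t \<omega> - w s \<omega>)
          (\<lambda>y. ennreal (\<Prod>i\<in>UNIV. normal_density 0 (sqrt (t - s)) (y $ i))) \<and>
        prob_space.indep_set M (sets (F s))
          {(\<lambda>\<omega>. w t \<omega> - w s \<omega>) -` B \<inter> space M | B. B \<in> sets borel})"

text \<open>Elementary integrands: the sum over \<open>i < n\<close> of \<open>H i\<close> times the indicator of the interval from
  \<open>r i\<close> (excluded) to \<open>r (i + 1)\<close> (included), where \<open>H i\<close> is bounded and known at time \<open>r i\<close>.\<close>

definition elementary ::
  "'w measure \<Rightarrow> (real \<Rightarrow> 'w measure) \<Rightarrow> nat \<Rightarrow> (nat \<Rightarrow> real) \<Rightarrow>
     (nat \<Rightarrow> 'w \<Rightarrow> real^'n::finite^'n) \<Rightarrow> bool" where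
  "elementary M F n r H \<longleftrightarrow>
     0 \<le> r 0 \<and> mono r \<and>
     (\<forall>i<n. H i \<in> borel_measurable (F (r i)) \<and> (\<exists>K. \<forall>\<omega>\<in>space M. norm (H i \<omega>) \<le> K))"

definition elem_process ::
  "nat \<Rightarrow> (nat \<Rightarrow> real) \<Rightarrow> (nat \<Rightarrow> 'w \<Rightarrow> real^'n::finite^'n) \<Rightarrow> real \<Rightarrow> 'w \<Rightarrow> real^'n^'n" where
  "elem_process n r H t \<omega> = (\<Sum>i<n. indicator {r i <.. r (Suc i)} t *\<^sub>R H i \<omega>)"

definition elem_integral ::
  "nat \<Rightarrow> (nat \<Rightarrow> real) \<Rightarrow> (nat \<Rightarrow> 'w \<Rightarrow> real^'n::finite^'n) \<Rightarrow> (real \<Rightarrow> 'w \<Rightarrow> real^'n) \<Rightarrow>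
     real \<Rightarrow> 'w \<Rightarrow> real^'n" where
  "elem_integral n r H w t \<omega> =
     (\<Sum>i<n. H i \<omega> *v (w (min t (r (Suc i))) \<omega> - w (min t (r i)) \<omega>))"

text \<open>\<open>J\<close> is a continuous version of the Ito integral process of \<open>\<sigma>\<close> with respect to \<open>w\<close>, as the
  L2-limit of integrals of elementary integrands. This covers all integrands that are
  square-integrable over finite time intervals, in particular the bounded ones used here.\<close>

definition ito_integral ::
  "'w measure \<Rightarrow> (real \<Rightarrow> 'w measure) \<Rightarrow> (real \<Rightarrow> 'w \<Rightarrow> real^'n::finite) \<Rightarrow>
     (real \<Rightarrow> 'w \<Rightarrow> real^'n^'n) \<Rightarrow> (real \<Rightarrow> 'w \<Rightarrow> real^'n) \<Rightarrow> bool" where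
  "ito_integral M F w \<sigma> J \<longleftrightarrow>
     adapted F J \<and> (AE \<omega> in M. continuous_on {0..} (\<lambda>t. J t \<omega>)) \<and>
     (\<exists>n r H.
        (\<forall>k. elementary M F (n k) (r k) (H k)) \<and>
        (\<forall>T\<ge>0. (\<lambda>k. \<integral>\<^sup>+ \<omega>. (\<integral>\<^sup>+ t\<in>{0..T}.
             ennreal ((norm (\<sigma> t \<omega> - elem_process (n k) (r k) (H k) t \<omega>))\<^sup>2) \<partial>lborel) \<partial>M)
           \<longlonglongrightarrow> 0) \<and>
        (\<forall>t\<ge>0. (\<lambda>k. \<integral>\<^sup>+ \<omega>.
             ennreal ((norm (J t \<omega> - elem_integral (n k) (r k) (H k) w t \<omega>))\<^sup>2) \<partial>M)
           \<longlonglongrightarrow> 0))"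

text \<open>The process \<open>x\<close>, started at 0, has the stochastic differential \<open>\<sigma> dw + b dt\<close>.\<close>

definition ito_process ::
  "'w measure \<Rightarrow> (real \<Rightarrow> 'w measure) \<Rightarrow> (real \<Rightarrow> 'w \<Rightarrow> real^'n::finite) \<Rightarrow>
     (real \<Rightarrow> 'w \<Rightarrow> real^'n^'n) \<Rightarrow> (real \<Rightarrow> 'w \<Rightarrow> real^'n) \<Rightarrow> (real \<Rightarrow> 'w \<Rightarrow> real^'n) \<Rightarrow> bool" where
  "ito_process M F w \<sigma> b x \<longleftrightarrow>
     complete_filtered_prob_space M F \<and> wiener_process M F w \<and>
     adapted F \<sigma> \<and> jointly_measurable M \<sigma> \<and> adapted F b \<and> jointly_measurable M b \<and> adapted F x \<and>
     (AE \<omega> in M. \<forall>T\<ge>0. set_integrable lborel {0..T} (\<lambda>s. b s \<omega>)) \<and>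
     (\<exists>J. ito_integral M F w \<sigma> J \<and>
        (AE \<omega> in M. \<forall>t\<ge>0. x t \<omega> = J t \<omega> + (LINT s:{0..t}|lborel. b s \<omega>)))"


section \<open>Diffusion-type processes\<close>

definition diffusion_type ::
  "real \<Rightarrow> real \<Rightarrow> real \<Rightarrow> ('n::finite spacetime \<Rightarrow> real) \<Rightarrow> (real \<Rightarrow> real) \<Rightarrow>
     'w measure \<Rightarrow> (real \<Rightarrow> 'w \<Rightarrow> real^'n) \<Rightarrow> bool" where
  "diffusion_type \<delta> p0 q0 h bbar M x \<longleftrightarrow>
     drift_bound p0 q0 h bbar \<and>
     (\<exists>F w \<sigma> b. ito_process M F w \<sigma> b x \<and>
        (\<forall>t\<ge>0. \<forall>\<omega>\<in>space M. \<sigma> t \<omega> \<in> S_delta \<delta> \<and> norm (b t \<omega>) \<le> h (t, x t \<omega>)))"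

definition first_time :: "(real \<Rightarrow> bool) \<Rightarrow> ereal" where
  "first_time A = (INF t\<in>{t. 0 \<le> t \<and> A t}. ereal t)"

text \<open>For the process \<open>x\<close> shifted to start at \<open>y\<close>: \<open>exit_cyl R\<close>, \<open>exit_ball R\<close> and \<open>hit_ball R\<close> are
  the first exit time of the space-time process from the cylinder of size \<open>R\<close> at the origin, the
  first exit time from the open ball and the first hitting time of the closed ball of radius \<open>R\<close>.\<close>

definition exit_cyl ::
  "real \<Rightarrow> (real \<Rightarrow> 'w \<Rightarrow> real^'n::finite) \<Rightarrow> real^'n \<Rightarrow> 'w \<Rightarrow> ereal" where
  "exit_cyl R x y \<omega> = first_time (\<lambda>t. (t, y + x t \<omega>) \<notin> cylinder R 0)"

definition exit_ball ::
  "real \<Rightarrow> (real \<Rightarrow> 'w \<Rightarrow> real^'n::finite) \<Rightarrow> real^'n \<Rightarrow> 'w \<Rightarrow> ereal" where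
  "exit_ball R x y \<omega> = first_time (\<lambda>t. y + x t \<omega> \<notin> ball 0 R)"

definition hit_ball ::
  "real \<Rightarrow> (real \<Rightarrow> 'w \<Rightarrow> real^'n::finite) \<Rightarrow> real^'n \<Rightarrow> 'w \<Rightarrow> ereal" where
  "hit_ball R x y \<omega> = first_time (\<lambda>t. y + x t \<omega> \<in> cball 0 R)"

text \<open>HOL cannot quantify over all probability spaces inside a formula. Below, the measures \<open>M\<close> range
  over all probability spaces whose points have type \<open>'n trajectory\<close>. The statements only concern
  the law of the process, and this type is large enough to carry a copy of every
  diffusion-type process together with its coefficients and Wiener process.\<close>

text \<open>\<open>xi \<delta>\<close> and \<open>Nbar p0 \<delta>\<close> are the constants \<open>\<xi>\<close>-bar and \<open>N\<close>-bar in dimension \<open>CARD('n)\<close>.\<close>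

definition exit_constants ::
  "'n::finite itself \<Rightarrow> (real \<Rightarrow> real) \<Rightarrow> (real \<Rightarrow> real \<Rightarrow> real) \<Rightarrow> bool" where
  "exit_constants (_ :: 'n::finite itself) xi Nbar \<longleftrightarrow>
     (\<forall>\<delta>\<in>{0<..<1}. 0 < xi \<delta> \<and> xi \<delta> < 1) \<and>
     (\<forall>p0 q0. admissible_exponents TYPE('n) p0 q0 \<longrightarrow>
        continuous_on {0<..<1} (Nbar p0) \<and>
        (\<forall>\<delta>\<in>{0<..<1}. \<forall>h bbar. \<forall>(M :: 'n trajectory measure) (x :: real \<Rightarrow> 'n trajectory \<Rightarrow> real^'n). \<forall>R>0.
           diffusion_type \<delta> p0 q0 h bbar M x \<and> Nbar p0 \<delta> * bbar R \<le> 1 \<longrightarrow>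
           (\<forall>y. norm y \<le> R \<longrightarrow>
              measure M {\<omega>\<in>space M. exit_cyl R x y \<omega> = ereal (R\<^sup>2)} \<le> 1 - xi \<delta>) \<and>
           measure M {\<omega>\<in>space M. exit_cyl R x 0 \<omega> = ereal (R\<^sup>2)} \<ge> xi \<delta> \<and>
           (\<forall>y. \<forall>n\<ge>1. norm y \<le> R \<longrightarrow>
              measure M {\<omega>\<in>space M. exit_ball R x y \<omega> \<ge> ereal (real n * R\<^sup>2)} \<le> (1 - xi \<delta>) ^ n) \<and>
           (\<forall>y. norm y \<le> 9 * R / 16 \<longrightarrow>
              measure M {\<omega>\<in>space M. exit_ball R x y \<omega> > hit_ball (R / 16) x y \<omega>} \<ge> xi \<delta>)))"


section \<open>The constant \<open>d\<^sub>0\<close>\<close>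

definition potential ::
  "real \<Rightarrow> 'w measure \<Rightarrow> (real \<Rightarrow> 'w \<Rightarrow> real^'n::finite) \<Rightarrow> ('n spacetime \<Rightarrow> real) \<Rightarrow> ennreal" where
  "potential l M x f =
     (\<integral>\<^sup>+ \<omega>. (\<integral>\<^sup>+ t\<in>{0..}. ennreal (exp (- l * t) * f (t, x t \<omega>)) \<partial>lborel) \<partial>M)"

definition potential_exit ::
  "real \<Rightarrow> 'w measure \<Rightarrow> (real \<Rightarrow> 'w \<Rightarrow> real^'n::finite) \<Rightarrow> real^'n \<Rightarrow> ('n spacetime \<Rightarrow> real) \<Rightarrow>
     ennreal" where
  "potential_exit R M x y f =
     (\<integral>\<^sup>+ \<omega>. (\<integral>\<^sup>+ t\<in>{t. 0 \<le> t \<and> ereal t < exit_cyl R x y \<omega>}.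
        ennreal (f (t, y + x t \<omega>)) \<partial>lborel) \<partial>M)"

definition nonneg_borel :: "('n::finite spacetime \<Rightarrow> real) \<Rightarrow> bool" where
  "nonneg_borel f \<longleftrightarrow> f \<in> borel_measurable borel \<and> (\<forall>z. 0 \<le> f z)"

definition green_function ::
  "real \<Rightarrow> 'w measure \<Rightarrow> (real \<Rightarrow> 'w \<Rightarrow> real^'n::finite) \<Rightarrow> ('n spacetime \<Rightarrow> real) \<Rightarrow> bool" where
  "green_function l M x G \<longleftrightarrow>
     nonneg_borel G \<and>
     (\<forall>f. nonneg_borel f \<longrightarrow>
        potential l M x f = (\<integral>\<^sup>+ z\<in>half_space. ennreal (G z * f z) \<partial>lborel))"

definition lam_dot :: "real \<Rightarrow> real \<Rightarrow> real" where
  "lam_dot Rlow l = l * min 1 (l * Rlow\<^sup>2)"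

definition lam_ddot :: "real \<Rightarrow> real \<Rightarrow> real \<Rightarrow> real" where
  "lam_ddot d d0 l = l * (min 1 l) powr (d / (2 * d0 - d))"

text \<open>\<open>Psi\<close> is used for \<open>t \<ge> 0\<close> only; \<open>xi0\<close> is the value of \<open>\<xi>\<close>-bar.\<close>

definition Psi :: "real \<Rightarrow> real \<Rightarrow> real \<Rightarrow> 'n::finite spacetime \<Rightarrow> real" where
  "Psi xi0 Rlow l z =
     exp (- sqrt (lam_dot Rlow l) * (norm (snd z) + sqrt (fst z)) * xi0 / 16)"

text \<open>In each of the three parts, the place of the quantifier over the constant \<open>N\<close> expresses what it
  depends on. In (ii) and (iii) it may also depend on the limit \<open>B\<close> of \<open>bbar\<close>, respectively on the
  value \<open>B\<close> of \<open>bbar\<close> at \<open>Rbar\<close>, but not otherwise on \<open>h\<close>, \<open>bbar\<close> and the process.\<close>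

definition d0_constant ::
  "'n::finite itself \<Rightarrow> (real \<Rightarrow> real) \<Rightarrow> (real \<Rightarrow> real \<Rightarrow> real) \<Rightarrow> real \<Rightarrow> real \<Rightarrow> real \<Rightarrow> real \<Rightarrow>
     real \<Rightarrow> bool" where
  "d0_constant (_ :: 'n::finite itself) xi Nbar \<delta> p0 q0 Rlow d0 \<longleftrightarrow>
     (let d = real CARD('n) in
     d / 2 < d0 \<and> d0 < d \<and>
     \<comment> \<open>(i)\<close>
     (\<forall>l>0. \<forall>p::real. p \<ge> d0 + 1 \<longrightarrow>
        (\<exists>N>0. \<forall>h bbar. \<forall>(M :: 'n trajectory measure) (x :: real \<Rightarrow> 'n trajectory \<Rightarrow> real^'n).
           diffusion_type \<delta> p0 q0 h bbar M x \<and> Nbar p0 \<delta> * bbar Rlow < 1 \<longrightarrow>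
           (\<exists>G. green_function l M x G \<and>
              (\<integral>\<^sup>+ z\<in>half_space. ennreal (G z powr (p / (p - 1))) \<partial>lborel) \<le> ennreal N))) \<and>
     \<comment> \<open>(ii)\<close>
     (\<forall>p q. 1 \<le> p \<and> 1 \<le> q \<and> nu d0 p q \<ge> 0 \<longrightarrow>
        (\<forall>B. \<exists>N>0. \<forall>h bbar. \<forall>(M :: 'n trajectory measure) (x :: real \<Rightarrow> 'n trajectory \<Rightarrow> real^'n).
           diffusion_type \<delta> p0 q0 h bbar M x \<and> Nbar p0 \<delta> * bbar Rlow < 1 \<and>
           (bbar \<longlongrightarrow> B) at_top \<longrightarrow>
           (\<forall>l>0. \<forall>f. nonneg_borel f \<longrightarrow>
              potential l M x f
              \<le> ennreal (N * lam_ddot d d0 l powr (- nu d0 p q + (d - 2 * d0) / 2 * rcp p)) *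
                mixed_norm p q half_space
                  (\<lambda>z. ennreal (Psi (xi \<delta>) Rlow l z powr (1 - nu d0 p q) * f z))))) \<and>
     \<comment> \<open>(iii)\<close>
     (\<forall>p q. 1 \<le> p \<and> 1 \<le> q \<and> nu d0 p q = 0 \<longrightarrow>
        (\<forall>Rbar\<ge>Rlow. \<forall>B. \<exists>N>0. \<forall>h bbar. \<forall>(M :: 'n trajectory measure) (x :: real \<Rightarrow> 'n trajectory \<Rightarrow> real^'n).
           diffusion_type \<delta> p0 q0 h bbar M x \<and> Nbar p0 \<delta> * bbar Rlow < 1 \<and>
           bbar Rbar = B \<longrightarrow>
           (\<forall>R y f. 0 < R \<and> R \<le> Rbar \<and> nonneg_borel f \<longrightarrow>
              potential_exit R M x y f
              \<le> ennreal (N * R powr ((2 * d0 - d) * rcp p)) *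
                mixed_norm p q (cylinder R 0) (\<lambda>z. ennreal (f z))))))"


section \<open>The Markov process\<close>

text \<open>Trajectories are functions on \<open>{0..}\<close>, extended by \<open>undefined\<close> to negative times so that
  distinct elements of \<open>path_space\<close> are distinct trajectories. At time \<open>s\<close> the trajectory \<open>\<omega>\<close> has
  time component \<open>fst (\<omega> s)\<close> and space component \<open>snd (\<omega> s)\<close>.\<close>

definition path_space :: "'n::finite trajectory set" where
  "path_space = {\<omega> \<in> extensional {0..}. continuous_on {0..} \<omega> \<and> (\<exists>t0. \<forall>t\<ge>0. fst (\<omega> t) = t0 + t)}"

definition path_sigma :: "real set \<Rightarrow> 'n::finite trajectory measure" where
  "path_sigma I =
     sigma path_space {(\<lambda>\<omega>. \<omega> s) -` A \<inter> path_space | s A. s \<in> I \<and> 0 \<le> s \<and> A \<in> sets borel}"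

definition Nfil :: "real \<Rightarrow> 'n::finite trajectory measure" where
  "Nfil t = path_sigma {..t}"

definition Nfil_plus :: "real \<Rightarrow> 'n::finite trajectory measure" where
  "Nfil_plus t = sigma path_space (\<Inter>u\<in>{t<..}. sets (Nfil u))"

text \<open>Dynkin's notions for infinite lifetime, with state space the whole of space-time.\<close>

definition markov_process ::
  "(real \<Rightarrow> 'n::finite trajectory measure) \<Rightarrow> ('n spacetime \<Rightarrow> 'n trajectory measure) \<Rightarrow> bool" where
  "markov_process F P \<longleftrightarrow>
     (\<forall>z. prob_space (P z) \<and> space (P z) = path_space \<and> sets (P z) = sets (path_sigma UNIV)) \<and>
     (\<forall>z. measure (P z) {\<omega>\<in>path_space. \<omega> 0 = z} = 1) \<and>
     (\<forall>s\<ge>0. \<forall>A\<in>sets borel.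
        (\<lambda>z. measure (P z) {\<omega>\<in>path_space. \<omega> s \<in> A}) \<in> borel_measurable borel) \<and>
     (\<forall>z. \<forall>t\<ge>0. \<forall>s\<ge>0. \<forall>A\<in>sets borel. \<forall>C\<in>sets (F t).
        measure (P z) {\<omega>\<in>C. \<omega> (t + s) \<in> A} =
        (LINT \<omega>:C|P z. measure (P (\<omega> t)) {\<omega>'\<in>path_space. \<omega>' s \<in> A}))"

definition strong_markov_process ::
  "(real \<Rightarrow> 'n::finite trajectory measure) \<Rightarrow> ('n spacetime \<Rightarrow> 'n trajectory measure) \<Rightarrow> bool" where
  "strong_markov_process F P \<longleftrightarrow>
     markov_process F P \<and>
     (\<forall>\<tau> :: 'n trajectory \<Rightarrow> ereal.
        (\<forall>\<omega>\<in>path_space. 0 \<le> \<tau> \<omega>) \<and> (\<forall>t\<ge>0. {\<omega>\<in>path_space. \<tau> \<omega> \<le> ereal t} \<in> sets (F t)) \<longrightarrow>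
        (\<forall>z. \<forall>s\<ge>0. \<forall>A\<in>sets borel. \<forall>C\<in>sets (path_sigma UNIV).
           (\<forall>t\<ge>0. {\<omega>\<in>C. \<tau> \<omega> \<le> ereal t} \<in> sets (F t)) \<longrightarrow>
           measure (P z) {\<omega>\<in>C. \<tau> \<omega> < \<infinity> \<and> \<omega> (real_of_ereal (\<tau> \<omega>) + s) \<in> A} =
           (LINT \<omega>:{\<omega>\<in>C. \<tau> \<omega> < \<infinity>}|P z.
              measure (P (\<omega> (real_of_ereal (\<tau> \<omega>)))) {\<omega>'\<in>path_space. \<omega>' s \<in> A})))"

definition completed_filtration ::
  "'w measure \<Rightarrow> (real \<Rightarrow> 'w measure) \<Rightarrow> real \<Rightarrow> 'w measure" where
  "completed_filtration M F s = sigma (space M) (sets (F s) \<union> null_sets (completion M))"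

definition markov_diffusion ::
  "(('n::finite) spacetime \<Rightarrow> real^'n^'n) \<Rightarrow> ('n spacetime \<Rightarrow> real^'n) \<Rightarrow>
     ('n spacetime \<Rightarrow> 'n trajectory measure) \<Rightarrow> bool" where
  "markov_diffusion \<sigma> b P \<longleftrightarrow>
     strong_markov_process Nfil P \<and> markov_process Nfil_plus P \<and>
     (\<forall>t x. (AE \<omega> in completion (P (t, x)). \<forall>s\<ge>0. fst (\<omega> s) = t + s) \<and>
        (\<exists>w. ito_process (completion (P (t, x))) (completed_filtration (P (t, x)) Nfil) w
               (\<lambda>s \<omega>. \<sigma> (t + s, snd (\<omega> s))) (\<lambda>s \<omega>. b (t + s, snd (\<omega> s)))
               (\<lambda>s \<omega>. snd (\<omega> s) - x)))"

definition resolvent ::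
  "real \<Rightarrow> ('n::finite spacetime \<Rightarrow> 'n trajectory measure) \<Rightarrow> ('n spacetime \<Rightarrow> real) \<Rightarrow>
     'n spacetime \<Rightarrow> ennreal" where
  "resolvent l P f z =
     (\<integral>\<^sup>+ \<omega>. (\<integral>\<^sup>+ s\<in>{0..}. ennreal (exp (- l * s) * f (fst z + s, snd (\<omega> s))) \<partial>lborel) \<partial>P z)"

end

theory Submission
  imports Defs
begin

text \<open>
  Fix a starting point \<open>z\<close>. The Markov process under \<open>P z\<close>, shifted to start at 0, is a diffusion-type
  process for the translate of \<open>h\<close> by \<open>z\<close>, which satisfies the drift condition with the same \<open>bbar\<close>.
  Property (ii) of \<open>d0\<close> therefore bounds \<open>resolvent l P f z\<close>, with a constant that does not depend on
  \<open>z\<close>, by a power of \<open>l\<close> times the mixed norm over the half-space of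
  \<open>y \<mapsto> Psi y powr (1 - nu) * f (z + y)\<close>.

  A function of \<open>z\<close> of this kind behaves like a convolution: its mixed norm is at most the mixed norm
  of the weight times that of \<open>f\<close> (\<open>mixed_norm_convolution\<close>). If both exponents are equal, this is
  Tonelli's theorem and translation invariance. In general one needs in addition Minkowski's integral
  inequality to interchange the two norms (\<open>minkowski_Lp_norm\<close>), and this goes in the right direction
  exactly because the larger exponent is integrated first.

  It remains to compute the norm of the weight. For \<open>l \<ge> 1\<close> the weight decays at least like
  \<open>exp (- c * sqrt l * (norm x + sqrt t))\<close>, so its mixed norm is at most a constant times
  \<open>l powr (- d / (2p) - 1/q)\<close> (\<open>mixed_norm_Psi\<close>). Property (ii) contributes
  \<open>l powr (- nu + (d - 2 * d0) / (2p))\<close>, and as \<open>nu = 1 - d0/p - 1/q\<close> the product of the two powers is \<open>1 / l\<close>.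

  When an exponent is infinite, the mixed norm involves an essential supremum and pointwise
  domination gives nothing for non-measurable functions. Hence the resolvent has to be shown to be
  Borel measurable (\<open>measurable_resolvent\<close>).
\<close>

section \<open>Powers of extended nonnegative reals\<close>

lemma epow_ennreal: "0 \<le> x \<Longrightarrow> epow (ennreal x) a = ennreal (x powr a)"
  by (simp add: epow_def)

lemma epow_top [simp]: "epow top a = top"
  by (simp add: epow_def infinity_ennreal_def)

lemma epow_0 [simp]: "epow 0 a = 0"
  by (simp add: epow_def infinity_ennreal_def)

lemma epow_1 [simp]: "epow 1 a = 1"
  by (simp add: epow_def infinity_ennreal_def)

lemma epow_one_exponent [simp]: "epow u 1 = u"
  by (cases u) (auto simp: epow_ennreal)

lemma measurable_epow [measurable (raw)]:
  assumes [measurable]: "f \<in> borel_measurable M"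
  shows "(\<lambda>x. epow (f x) a) \<in> borel_measurable M"
  unfolding epow_def by measurable

lemma epow_mono: "u \<le> v \<Longrightarrow> 0 < a \<Longrightarrow> epow u a \<le> epow v a"
  by (cases u; cases v) (auto simp: epow_ennreal intro!: ennreal_leI powr_mono2 simp: top_unique)

lemma epow_mult: "0 < a \<Longrightarrow> epow (u * v) a = epow u a * epow v a"
  by (cases u; cases v)
    (auto simp: epow_ennreal powr_mult simp flip: ennreal_mult simp: ennreal_mult_top ennreal_top_mult)

lemma epow_epow: "epow (epow u a) b = epow u (a * b)"
  by (cases u) (auto simp: epow_ennreal powr_powr)

lemma epow_le_iff: "0 < a \<Longrightarrow> epow u a \<le> v \<longleftrightarrow> u \<le> epow v (1 / a)"
  using epow_mono[of "epow u a" v "1 / a"] epow_mono[of u "epow v (1 / a)" a]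
  by (auto simp: epow_epow)

lemma powr_ge_tangent:
  fixes x k :: real
  assumes "0 \<le> x" "1 \<le> k"
  shows "k * x \<le> x powr k + (k - 1)"
proof (cases "x = 0")
  case False
  then have "x \<le> 1 / k * x powr k + (1 - 1 / k)"
    using Youngs_inequality_0[of "1 / k" "1 - 1 / k" "x powr k" 1] assms
    by (simp add: powr_powr)
  then have "k * x \<le> k * (1 / k * x powr k + (1 - 1 / k))"
    using assms by (intro mult_left_mono) auto
  also have "\<dots> = x powr k + (k - 1)"
    using assms by (simp add: distrib_left right_diff_distrib)
  finally show ?thesis .
qed (use assms in auto)

text \<open>The power function lies above its tangent at 1. With \<open>m\<close> the mean of \<open>f\<close>, this inequality for
  \<open>c * f\<close>, \<open>c = 1/m\<close>, integrates to the claim. The same inequality with \<open>c = 1\<close> settles the case \<open>m = \<infinity>\<close>.\<close>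

lemma epow_jensen:
  assumes M: "prob_space M" and [measurable]: "f \<in> borel_measurable M" and k: "1 \<le> k"
  shows "epow (\<integral>\<^sup>+x. f x \<partial>M) k \<le> (\<integral>\<^sup>+x. epow (f x) k \<partial>M)"
proof -
  interpret prob_space M by fact
  let ?m = "\<integral>\<^sup>+x. f x \<partial>M" and ?S = "\<integral>\<^sup>+x. epow (f x) k \<partial>M"
  have tangent: "ennreal k * u \<le> epow u k + ennreal (k - 1)" for u
    using k powr_ge_tangent[of "enn2real u" k]
    by (cases u) (auto simp: epow_ennreal simp flip: ennreal_mult ennreal_plus intro!: ennreal_leI)
  have *: "ennreal k * (c * ?m) \<le> epow c k * ?S + ennreal (k - 1)" for c
  proof -
    have "ennreal k * (c * ?m) = (\<integral>\<^sup>+x. ennreal k * (c * f x) \<partial>M)"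
      by (simp add: nn_integral_cmult)
    also have "\<dots> \<le> (\<integral>\<^sup>+x. epow c k * epow (f x) k + ennreal (k - 1) \<partial>M)"
      using k by (intro nn_integral_mono) (use tangent[of "c * f x" for x] in \<open>simp add: epow_mult\<close>)
    also have "\<dots> = epow c k * ?S + ennreal (k - 1)"
      using k by (simp add: nn_integral_add nn_integral_cmult emeasure_space_1)
    finally show ?thesis .
  qed
  show ?thesis
  proof (cases ?m)
    case top
    have "?S = top"
      using *[of 1] k by (auto simp: top ennreal_mult_top top_unique)
    then show ?thesis by simp
  next
    case (real m)
    show ?thesis
    proof (cases "m = 0 \<or> ?S = top")
      case False
      with real obtain s where s: "?S = ennreal s" "0 \<le> s" and m: "0 < m"
        by (cases ?S) auto
      have "ennreal k \<le> ennreal ((1 / m) powr k * s + (k - 1))"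
        using *[of "ennreal (1 / m)"] real m k s
        by (simp add: epow_ennreal flip: ennreal_mult ennreal_plus)
      then have "k \<le> (1 / m) powr k * s + (k - 1)"
        using k s by (subst (asm) ennreal_le_iff) auto
      then have "m powr k \<le> s"
        using m by (simp add: powr_divide field_simps)
      then show ?thesis
        using real s by (simp add: epow_ennreal)
    qed (use real in auto)
  qed
qed

text \<open>Let \<open>J x\<close> be the norm of the section at \<open>x\<close>. Jensen's inequality for the probability measure with
  density proportional to \<open>J\<close> bounds the power of the inner integral by an integral of powers; after
  exchanging the integrals, the weights turn each section norm into the same constant. Since \<open>J\<close> may
  vanish, it is replaced by \<open>w = J + e * w0\<close> with a positive integrable function \<open>w0\<close>, and \<open>e\<close> tends to 0
  at the end. Compared with the duality proof, this needs no truncation to make the left-hand side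
  finite.\<close>

lemma minkowski_integral:
  assumes A: "sigma_finite_measure A" and B: "sigma_finite_measure B"
    and g [measurable]: "(\<lambda>(x, y). g x y) \<in> borel_measurable (A \<Otimes>\<^sub>M B)" and k: "1 \<le> k"
  shows "epow (\<integral>\<^sup>+y. epow (\<integral>\<^sup>+x. g x y \<partial>A) k \<partial>B) (1 / k)
           \<le> (\<integral>\<^sup>+x. epow (\<integral>\<^sup>+y. epow (g x y) k \<partial>B) (1 / k) \<partial>A)"
proof -
  interpret A: sigma_finite_measure A by fact
  interpret B: sigma_finite_measure B by fact
  interpret pair_sigma_finite A B ..
  define J where "J x = epow (\<integral>\<^sup>+y. epow (g x y) k \<partial>B) (1 / k)" for x
  have J[measurable]: "J \<in> borel_measurable A"
    unfolding J_def by measurable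
  define I where "I = (\<integral>\<^sup>+x. J x \<partial>A)"
  let ?L = "\<integral>\<^sup>+y. epow (\<integral>\<^sup>+x. g x y \<partial>A) k \<partial>B"
  obtain w0 where w0[measurable]: "w0 \<in> borel_measurable A" and fin: "(\<integral>\<^sup>+x. w0 x \<partial>A) \<noteq> \<infinity>"
    and w0_pos: "\<And>x. x \<in> space A \<Longrightarrow> 0 < w0 x \<and> w0 x < \<infinity>"
    using A.Ex_finite_integrable_function by blast
  define c where "c = enn2real (\<integral>\<^sup>+x. w0 x \<partial>A)"
  have c: "(\<integral>\<^sup>+x. w0 x \<partial>A) = ennreal c" "0 \<le> c"
    using fin by (auto simp: c_def less_top)
  have bound: "epow ?L (1 / k) \<le> I + ennreal (e * c)" if e: "0 < e" and I: "I < top" for e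
  proof -
    define w where "w x = J x + ennreal e * w0 x" for x
    define W where "W = (\<integral>\<^sup>+x. w x \<partial>A)"
    have w[measurable]: "w \<in> borel_measurable A"
      unfolding w_def by measurable
    have W: "W = I + ennreal (e * c)"
      unfolding W_def w_def I_def using e c
      by (simp add: nn_integral_add nn_integral_cmult flip: ennreal_mult)
    have W_fin: "W < top"
      using W I by simp
    have w_pos: "0 < w x" if "x \<in> space A" for x
      using w0_pos[OF that] e by (auto simp: w_def ennreal_zero_less_mult_iff add_pos_nonneg add_nonneg_pos)
    have w_fin: "AE x in A. w x < top"
      using nn_integral_PInf_AE[of w A] W_fin by (auto simp: W_def less_top[symmetric])
    show ?thesis
    proof (cases "W = 0")
      case True
      \<comment> \<open>A positive function with integral 0: the whole space is a null set.\<close>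
      then have "AE x in A. w x = 0"
        by (simp add: W_def nn_integral_0_iff_AE)
      then have "AE x in A. False"
        using AE_space by eventually_elim (use w_pos in force)
      then have "(\<integral>\<^sup>+x. g x y \<partial>A) = 0" for y
        by (subst nn_integral_cong_AE[of _ "\<lambda>_. 0"]) auto
      then show ?thesis by simp
    next
      case False
      \<comment> \<open>The probability measure to which Jensen is applied.\<close>
      define D where "D = density A (\<lambda>x. w x / W)"
      have D: "prob_space D"
        using False W_fin by (intro prob_spaceI)
          (simp add: D_def emeasure_density nn_integral_divide ennreal_divide_self W_def[symmetric])
      have split: "(\<integral>\<^sup>+x. g x y \<partial>A) = (\<integral>\<^sup>+x. g x y * (W / w x) \<partial>D)"
        if y[measurable]: "y \<in> space B" for y
      proof -
        have "(\<integral>\<^sup>+x. g x y * (W / w x) \<partial>D) = (\<integral>\<^sup>+x. (w x / W) * (g x y * (W / w x)) \<partial>A)"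
          unfolding D_def by (subst nn_integral_density) auto
        also have "\<dots> = (\<integral>\<^sup>+x. g x y \<partial>A)"
        proof (intro nn_integral_cong_AE)
          show "AE x in A. w x / W * (g x y * (W / w x)) = g x y"
            using w_fin AE_space
          proof eventually_elim
            case (elim x)
            then have "0 < w x" using w_pos by simp
            then have "w x / W * (W / w x) = 1"
              using elim False W_fin
              by (simp add: ennreal_times_divide ennreal_divide_times ennreal_divide_self mult_divide_eq_ennreal mult.commute)
            then show ?case
              by (metis mult.assoc mult.commute mult.right_neutral)
          qed
        qed
        finally show ?thesis ..
      qed
      have "?L \<le> (\<integral>\<^sup>+y. (\<integral>\<^sup>+x. epow (g x y * (W / w x)) k \<partial>D) \<partial>B)"
      proof (intro nn_integral_mono)
        fix y assume y[measurable]: "y \<in> space B"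
        show "epow (\<integral>\<^sup>+x. g x y \<partial>A) k \<le> (\<integral>\<^sup>+x. epow (g x y * (W / w x)) k \<partial>D)"
          unfolding split[OF y] using k by (intro epow_jensen D) (auto simp: D_def)
      qed
      also have "\<dots> = (\<integral>\<^sup>+y. (\<integral>\<^sup>+x. w x / W * epow (g x y * (W / w x)) k \<partial>A) \<partial>B)"
        unfolding D_def by (intro nn_integral_cong, subst nn_integral_density) auto
      also have "\<dots> = (\<integral>\<^sup>+x. (\<integral>\<^sup>+y. w x / W * epow (g x y * (W / w x)) k \<partial>B) \<partial>A)"
        by (subst Fubini') auto
      also have "\<dots> \<le> (\<integral>\<^sup>+x. w x / W * epow W k \<partial>A)"
      proof (intro nn_integral_mono)
        fix x assume x[measurable]: "x \<in> space A"
        have "(\<integral>\<^sup>+y. w x / W * epow (g x y * (W / w x)) k \<partial>B)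
            = w x / W * (epow (J x) k * epow (W / w x) k)"
          using k by (simp add: J_def epow_epow epow_mult nn_integral_cmult nn_integral_multc mult.assoc)
        also have "epow (J x) k * epow (W / w x) k = epow (J x * (W / w x)) k"
          using k by (simp add: epow_mult)
        also have "J x * (W / w x) \<le> W"
        proof -
          have "J x * (W / w x) = W * (J x / w x)"
            by (simp add: ennreal_times_divide mult.commute)
          also have "J x / w x \<le> 1"
            using w_pos[OF x] by (auto simp: w_def divide_le_posI_ennreal)
          finally show ?thesis
            by (metis mult.right_neutral mult_left_mono zero_le)
        qed
        then have "epow (J x * (W / w x)) k \<le> epow W k"
          using k by (intro epow_mono) auto
        finally show "(\<integral>\<^sup>+y. w x / W * epow (g x y * (W / w x)) k \<partial>B) \<le> w x / W * epow W k"
          by (simp add: mult_left_mono)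
      qed
      also have "\<dots> = epow W k"
        using False W_fin by (simp add: nn_integral_multc nn_integral_divide ennreal_divide_self W_def[symmetric])
      finally have "?L \<le> epow W k" .
      then show ?thesis
        using k by (subst epow_le_iff) (auto simp: W)
    qed
  qed
  have "epow ?L (1 / k) \<le> I"
  proof (cases "I < top")
    case True
    show ?thesis
    proof (rule ennreal_le_epsilon)
      fix e :: real assume e: "0 < e"
      have "epow ?L (1 / k) \<le> I + ennreal (e / (c + 1) * c)"
        using e c True by (intro bound) auto
      also have "e / (c + 1) * c \<le> e"
        using e c by (simp add: field_simps)
      finally show "epow ?L (1 / k) \<le> I + ennreal e"
        by (simp add: ennreal_leI add_left_mono)
    qed
  qed (auto simp: not_less top_unique)
  then show ?thesis
    by (simp add: I_def J_def)
qed


section \<open>Lebesgue norms\<close>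

lemma exponent_cases:
  fixes p :: ennreal
  assumes "1 \<le> p"
  obtains "p = top" | P where "p = ennreal P" "1 \<le> P"
  using assms by (cases p) auto

lemma rcp_ennreal [simp]: "1 \<le> P \<Longrightarrow> rcp (ennreal P) = 1 / P"
  by (simp add: rcp_def inverse_ennreal field_simps)

lemma rcp_top [simp]: "rcp top = 0"
  by (simp add: rcp_def)

lemma Lp_norm_top: "Lp_norm M top f = esssup M f"
  by (simp add: Lp_norm_def)

lemma Lp_norm_ennreal:
  "1 \<le> P \<Longrightarrow> Lp_norm M (ennreal P) f = epow (\<integral>\<^sup>+y. epow (f y) P \<partial>M) (1 / P)"
  by (simp add: Lp_norm_def)

lemma Lp_norm_mono_AE:
  assumes "1 \<le> p" "u \<in> borel_measurable M" "AE x in M. u x \<le> v x"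
  shows "Lp_norm M p u \<le> Lp_norm M p v"
  using assms(1)
proof (cases p rule: exponent_cases)
  case 1
  then show ?thesis
    using assms by (auto simp: Lp_norm_top intro: esssup_AE_mono)
next
  case (2 P)
  have "(\<integral>\<^sup>+y. epow (u y) P \<partial>M) \<le> (\<integral>\<^sup>+y. epow (v y) P \<partial>M)"
    using assms(3) 2 by (intro nn_integral_mono_AE) (auto intro: epow_mono elim!: eventually_mono)
  then show ?thesis
    using 2 by (auto simp: Lp_norm_ennreal intro: epow_mono)
qed

lemma Lp_norm_mono:
  assumes "1 \<le> p" "u \<in> borel_measurable M" "\<And>x. x \<in> space M \<Longrightarrow> u x \<le> v x"
  shows "Lp_norm M p u \<le> Lp_norm M p v"
  using assms by (intro Lp_norm_mono_AE) auto

lemma Lp_norm_cmult: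
  assumes "1 \<le> p" and [measurable]: "u \<in> borel_measurable M"
  shows "Lp_norm M p (\<lambda>x. c * u x) \<le> c * Lp_norm M p u"
  using assms(1)
proof (cases p rule: exponent_cases)
  case 1
  have "AE x in M. c * u x \<le> c * esssup M u"
    using esssup_AE[of u M] by eventually_elim (rule mult_left_mono, auto)
  then show ?thesis
    using 1 by (auto simp: Lp_norm_top intro!: esssup_I)
next
  case (2 P)
  then show ?thesis
    by (simp add: Lp_norm_ennreal epow_mult nn_integral_cmult epow_epow)
qed

text \<open>For \<open>p = \<infinity>\<close>, the essential supremum of a section is at most \<open>c\<close> iff the section exceeds \<open>c\<close> on a
  null set only, and the measure of that set depends measurably on the section.\<close>

lemma measurable_Lp_norm:
  assumes B: "sigma_finite_measure B"
    and g [measurable]: "(\<lambda>(x, y). g x y) \<in> borel_measurable (A \<Otimes>\<^sub>M B)"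
  shows "(\<lambda>x. Lp_norm B p (g x)) \<in> borel_measurable A"
proof (cases "p = top")
  case True
  interpret B: sigma_finite_measure B by fact
  have *: "esssup B (g x) \<le> c \<longleftrightarrow> emeasure B {y \<in> space B. c < g x y} = 0"
    if [measurable]: "x \<in> space A" for x c
  proof -
    have "emeasure B {y \<in> space B. c < g x y} = 0 \<longleftrightarrow> (AE y in B. g x y \<le> c)"
      by (subst AE_iff_measurable[OF _ refl]) (auto simp: not_le)
    also have "\<dots> \<longleftrightarrow> esssup B (g x) \<le> c"
      using esssup_AE[of "g x" B] by (auto intro: esssup_I elim!: eventually_mono order_trans)
    finally show ?thesis ..
  qed
  have "{x \<in> space A. emeasure B {y \<in> space B. c < g x y} = 0} \<in> sets A" for c
    by measurable
  then have "(\<lambda>x. esssup B (g x)) \<in> borel_measurable A"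
    by (intro borel_measurableI_le) (simp add: * cong: conj_cong)
  then show ?thesis
    using True by (simp add: Lp_norm_top)
next
  case False
  interpret B: sigma_finite_measure B by fact
  show ?thesis
    using False by (simp add: Lp_norm_def)
qed

text \<open>Moving the larger exponent inside increases a mixed norm. For finite exponents this is Minkowski's
  integral inequality with exponent \<open>s / r\<close> for the function \<open>g\<close> raised to the power \<open>r\<close>. For
  \<open>s = \<infinity>\<close> almost every point of the product lies below the essential supremum of its section, and
  almost-everywhere quantifiers commute.\<close>

lemma minkowski_Lp_norm:
  assumes A: "sigma_finite_measure A" and B: "sigma_finite_measure B"
    and g [measurable]: "(\<lambda>(x, y). g x y) \<in> borel_measurable (A \<Otimes>\<^sub>M B)"
    and rs: "1 \<le> r" "r \<le> s"
  shows "Lp_norm B s (\<lambda>y. Lp_norm A r (\<lambda>x. g x y)) \<le> Lp_norm A r (\<lambda>x. Lp_norm B s (g x))"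
proof -
  interpret A: sigma_finite_measure A by fact
  interpret B: sigma_finite_measure B by fact
  interpret pair_sigma_finite A B ..
  have "1 \<le> s" using rs by (rule order_trans)
  then show ?thesis
  proof (cases s rule: exponent_cases)
    case 1
    have [measurable]: "(\<lambda>y. Lp_norm A r (\<lambda>x. g x y)) \<in> borel_measurable B"
      by (rule measurable_Lp_norm[OF A]) measurable
    have [measurable]: "(\<lambda>x. Lp_norm B s (g x)) \<in> borel_measurable A"
      by (rule measurable_Lp_norm[OF B]) measurable
    have "AE x in A. AE y in B. g x y \<le> Lp_norm B s (g x)"
      using 1 esssup_AE by (auto simp: Lp_norm_top)
    then have "AE y in B. AE x in A. g x y \<le> Lp_norm B s (g x)"
      by (subst (asm) AE_commute) measurable
    then have "AE y in B. Lp_norm A r (\<lambda>x. g x y) \<le> Lp_norm A r (\<lambda>x. Lp_norm B s (g x))"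
      using AE_space by eventually_elim (intro Lp_norm_mono_AE rs, auto)
    then have "esssup B (\<lambda>y. Lp_norm A r (\<lambda>x. g x y)) \<le> Lp_norm A r (\<lambda>x. Lp_norm B s (g x))"
      by (intro esssup_I) auto
    then show ?thesis
      using 1 by (simp add: Lp_norm_top)
  next
    case (2 S)
    from rs(1) show ?thesis
    proof (cases r rule: exponent_cases)
      case r: (2 R)
      then have RS: "R \<le> S" using rs 2 by simp
      have "epow (\<integral>\<^sup>+y. epow (\<integral>\<^sup>+x. epow (g x y) R \<partial>A) (S / R) \<partial>B) (1 / (S / R))
         \<le> (\<integral>\<^sup>+x. epow (\<integral>\<^sup>+y. epow (epow (g x y) R) (S / R) \<partial>B) (1 / (S / R)) \<partial>A)"
        using RS r by (intro minkowski_integral A B) auto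
      then have "epow (epow (\<integral>\<^sup>+y. epow (\<integral>\<^sup>+x. epow (g x y) R \<partial>A) (S / R) \<partial>B) (1 / (S / R))) (1 / R)
         \<le> epow (\<integral>\<^sup>+x. epow (\<integral>\<^sup>+y. epow (epow (g x y) R) (S / R) \<partial>B) (1 / (S / R)) \<partial>A) (1 / R)"
        using r by (intro epow_mono) auto
      then show ?thesis
        using 2 r by (simp add: Lp_norm_ennreal epow_epow)
    qed (use rs 2 in \<open>auto simp: top_unique\<close>)
  qed
qed

lemma Lp_norm_translate:
  fixes F :: "'a::euclidean_space \<Rightarrow> ennreal"
  assumes [measurable]: "F \<in> borel_measurable borel"
  shows "Lp_norm lborel p (\<lambda>y. F (c + y)) = Lp_norm lborel p F"
proof (cases "p = top")
  case True
  have "(AE y in lborel. F (c + y) \<le> z) \<longleftrightarrow> (AE y in lborel. F y \<le> z)" for z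
    by (subst (2) lborel_distr_plus[of c, symmetric], subst AE_distr_iff) auto
  then show ?thesis
    using True by (simp add: Lp_norm_top esssup_eq_AE)
next
  case False
  have "(\<integral>\<^sup>+y. epow (F (c + y)) a \<partial>lborel) = (\<integral>\<^sup>+y. epow (F y) a \<partial>lborel)" for a
    by (subst (2) lborel_distr_plus[of c, symmetric], subst nn_integral_distr) auto
  with False show ?thesis
    by (simp add: Lp_norm_def)
qed

text \<open>For finite \<open>p\<close> both sides agree, by Tonelli and translation invariance. For \<open>p = \<infinity>\<close> the
  integrand is almost everywhere at most the product of the essential suprema, for each \<open>x\<close>.\<close>

lemma Lp_norm_convolution:
  fixes F :: "'a::euclidean_space \<Rightarrow> ennreal"
  assumes p: "1 \<le> p" and [measurable]: "U \<in> borel_measurable borel" "F \<in> borel_measurable borel"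
  shows "Lp_norm lborel p (\<lambda>x. Lp_norm lborel p (\<lambda>y. U y * F (x + y)))
           \<le> Lp_norm lborel p U * Lp_norm lborel p F"
  using p
proof (cases p rule: exponent_cases)
  case 1
  have [measurable]: "(\<lambda>x. Lp_norm lborel p (\<lambda>y. U y * F (x + y))) \<in> borel_measurable borel"
    by (rule measurable_Lp_norm) (auto intro: lborel.sigma_finite_measure_axioms)
  have "Lp_norm lborel p (\<lambda>y. U y * F (x + y)) \<le> Lp_norm lborel p U * Lp_norm lborel p F" for x
  proof -
    have "AE y in lborel. U y \<le> Lp_norm lborel p U" "AE y in lborel. F (x + y) \<le> Lp_norm lborel p F"
      using 1 esssup_AE[of U lborel] esssup_AE[of "\<lambda>y. F (x + y)" lborel] Lp_norm_translate[of F p x]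
      by (auto simp: Lp_norm_top)
    then have "AE y in lborel. U y * F (x + y) \<le> Lp_norm lborel p U * Lp_norm lborel p F"
      by eventually_elim (rule mult_mono, auto)
    then show ?thesis
      using 1 by (auto simp: Lp_norm_top intro!: esssup_I)
  qed
  then have "esssup lborel (\<lambda>x. Lp_norm lborel p (\<lambda>y. U y * F (x + y)))
      \<le> Lp_norm lborel p U * Lp_norm lborel p F"
    by (intro esssup_I) auto
  then show ?thesis
    using 1 by (simp add: Lp_norm_top)
next
  case (2 P)
  have "(\<integral>\<^sup>+x. \<integral>\<^sup>+y. epow (U y) P * epow (F (x + y)) P \<partial>lborel \<partial>lborel)
      = (\<integral>\<^sup>+y. \<integral>\<^sup>+x. epow (U y) P * epow (F (x + y)) P \<partial>lborel \<partial>lborel)"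
    by (rule lborel_pair.Fubini') measurable
  also have "\<dots> = (\<integral>\<^sup>+y. epow (U y) P * (\<integral>\<^sup>+x. epow (F (y + x)) P \<partial>lborel) \<partial>lborel)"
    by (simp add: nn_integral_cmult add.commute)
  also have "\<dots> = (\<integral>\<^sup>+y. epow (U y) P * (\<integral>\<^sup>+x. epow (F x) P \<partial>lborel) \<partial>lborel)"
  proof -
    have "(\<integral>\<^sup>+x. epow (F (y + x)) P \<partial>lborel) = (\<integral>\<^sup>+x. epow (F x) P \<partial>lborel)" for y
      by (subst (2) lborel_distr_plus[of y, symmetric], subst nn_integral_distr) auto
    then show ?thesis by simp
  qed
  finally have "(\<integral>\<^sup>+x. \<integral>\<^sup>+y. epow (U y) P * epow (F (x + y)) P \<partial>lborel \<partial>lborel)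
      = (\<integral>\<^sup>+y. epow (U y) P \<partial>lborel) * (\<integral>\<^sup>+x. epow (F x) P \<partial>lborel)"
    by (simp add: nn_integral_multc)
  then show ?thesis
    using 2 by (simp add: Lp_norm_ennreal epow_epow epow_mult)
qed

text \<open>Each of the two variables contributes one use of the preceding inequality. The obstacle is the
  order of the norms: after taking the \<open>s\<close>-norm in \<open>b\<close>, the \<open>r\<close>-norm in \<open>a'\<close> still separates it
  from the \<open>s\<close>-norm in \<open>b'\<close>. Minkowski's inequality moves it outside because \<open>r \<le> s\<close>. Measurability of
  \<open>U\<close> matters because the essential supremum of a non-measurable function is infinite.\<close>

lemma mixed_Lp_convolution:
  fixes F \<Phi> U :: "'a::euclidean_space \<Rightarrow> 'b::euclidean_space \<Rightarrow> ennreal"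
  assumes rs: "1 \<le> r" "r \<le> s"
    and [measurable]: "case_prod U \<in> borel_measurable (borel \<Otimes>\<^sub>M borel)"
      "case_prod \<Phi> \<in> borel_measurable (borel \<Otimes>\<^sub>M borel)"
      "case_prod F \<in> borel_measurable (borel \<Otimes>\<^sub>M borel)"
    and U: "\<And>a b. U a b \<le> C * Lp_norm lborel r (\<lambda>a'. Lp_norm lborel s (\<lambda>b'. \<Phi> a' b' * F (a + a') (b + b')))"
  shows "Lp_norm lborel r (\<lambda>a. Lp_norm lborel s (U a))
           \<le> C * (Lp_norm lborel r (\<lambda>a. Lp_norm lborel s (\<Phi> a)) * Lp_norm lborel r (\<lambda>a. Lp_norm lborel s (F a)))"
proof -
  have s: "1 \<le> s" using rs by (rule order_trans)
  note sf = lborel.sigma_finite_measure_axioms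
  have m1[measurable]: "(\<lambda>x. Lp_norm lborel p (g x)) \<in> borel_measurable M"
    if [measurable]: "(\<lambda>(x, y). g x y) \<in> borel_measurable (M \<Otimes>\<^sub>M borel)"
    for M :: "'m measure" and p and g :: "'m \<Rightarrow> 'c::euclidean_space \<Rightarrow> ennreal"
    by (rule measurable_Lp_norm[OF sf]) measurable
  let ?c = "\<lambda>a a' b. Lp_norm lborel s (\<lambda>b'. \<Phi> a' b' * F (a + a') (b + b'))"
  let ?n = "\<lambda>a. Lp_norm lborel s (\<Phi> a)" and ?m = "\<lambda>a. Lp_norm lborel s (F a)"
  have "(\<lambda>z. Lp_norm lborel s (\<lambda>b'. \<Phi> (fst z) b' * F (a + fst z) (snd z + b')))
      \<in> borel_measurable (lborel \<Otimes>\<^sub>M lborel)" for a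
    by (rule m1) measurable
  then have c: "(\<lambda>(a', b). ?c a a' b) \<in> borel_measurable (lborel \<Otimes>\<^sub>M lborel)" for a
    by (simp add: split_beta')
  have [measurable]: "\<Phi> a \<in> borel_measurable borel" "F a \<in> borel_measurable borel" for a
    using measurable_Pair2[OF assms(4), of a] measurable_Pair2[OF assms(5), of a] by simp_all
  have nm[measurable]: "?n \<in> borel_measurable borel" "?m \<in> borel_measurable borel"
    by (rule m1, rule assms(4)) (rule m1, rule assms(5))
  have inner: "Lp_norm lborel s (U a) \<le> C * Lp_norm lborel r (\<lambda>a'. ?n a' * ?m (a + a'))" for a
  proof -
    have "Lp_norm lborel s (U a) \<le> Lp_norm lborel s (\<lambda>b. C * Lp_norm lborel r (\<lambda>a'. ?c a a' b))"
      by (intro Lp_norm_mono s U) measurable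
    also have "\<dots> \<le> C * Lp_norm lborel s (\<lambda>b. Lp_norm lborel r (\<lambda>a'. ?c a a' b))"
      by (intro Lp_norm_cmult s) measurable
    also have "\<dots> \<le> C * Lp_norm lborel r (\<lambda>a'. Lp_norm lborel s (?c a a'))"
      by (intro mult_left_mono minkowski_Lp_norm sf rs c) auto
    also have "\<dots> \<le> C * Lp_norm lborel r (\<lambda>a'. ?n a' * ?m (a + a'))"
      using measurable_Lp_norm[OF sf c]
      by (intro mult_left_mono Lp_norm_mono rs Lp_norm_convolution s) auto
    finally show ?thesis .
  qed
  have "Lp_norm lborel r (\<lambda>a. Lp_norm lborel s (U a))
      \<le> Lp_norm lborel r (\<lambda>a. C * Lp_norm lborel r (\<lambda>a'. ?n a' * ?m (a + a')))"
    by (intro Lp_norm_mono rs inner) measurable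
  also have "\<dots> \<le> C * Lp_norm lborel r (\<lambda>a. Lp_norm lborel r (\<lambda>a'. ?n a' * ?m (a + a')))"
    by (intro Lp_norm_cmult rs) measurable
  also have "\<dots> \<le> C * (Lp_norm lborel r ?n * Lp_norm lborel r ?m)"
    by (intro mult_left_mono Lp_norm_convolution rs nm) auto
  finally show ?thesis .
qed

section \<open>Norms of exponential weights\<close>

text \<open>Layer-cake formula: \<open>exp (- c * g)\<close> is the integral of \<open>exp (- r)\<close> over \<open>r \<ge> c * g\<close>, and Tonelli turns
  the integral into the Gamma integral of \<open>r ^ k * exp (- r)\<close>. Working with volumes of sublevel sets
  treats \<open>norm x\<close> (with \<open>k\<close> the dimension) and \<open>sqrt t\<close> (with \<open>k = 2\<close>) alike and gives the scaling in \<open>c\<close>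
  without a change of variables.\<close>

lemma nn_integral_exp_sublevel:
  assumes M: "sigma_finite_measure M"
    and [measurable]: "g \<in> borel_measurable M" "A \<in> sets M"
    and g: "\<And>x. x \<in> A \<Longrightarrow> 0 \<le> g x"
    and vol: "\<And>r. 0 \<le> r \<Longrightarrow> emeasure M {x \<in> A. g x \<le> r} \<le> ennreal (V * r ^ k)"
    and V: "0 \<le> V" and c: "0 < c"
  shows "(\<integral>\<^sup>+x\<in>A. ennreal (exp (- c * g x)) \<partial>M) \<le> ennreal (V * fact k / c ^ k)"
proof -
  interpret M: sigma_finite_measure M by fact
  interpret pair_sigma_finite M lborel ..
  have A: "A \<subseteq> space M"
    by (rule sets.sets_into_space) measurable
  have tail: "ennreal (exp (- u)) = (\<integral>\<^sup>+r. ennreal (exp (- r)) * indicator {u..} r \<partial>lborel)" for u :: real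
  proof -
    have "((\<lambda>r :: real. exp (- r)) \<longlongrightarrow> 0) at_top"
      by (rule filterlim_compose[OF exp_at_bot filterlim_uminus_at_bot_at_top])
    from tendsto_minus[OF this] have "(\<integral>\<^sup>+r. ennreal (exp (- r)) * indicator {u..} r \<partial>lborel) = ennreal (0 - (- exp (- u)))"
      by (intro nn_integral_FTC_atLeast) (auto intro!: derivative_eq_intros)
    then show ?thesis by simp
  qed
  have "(\<integral>\<^sup>+x\<in>A. ennreal (exp (- c * g x)) \<partial>M)
      = (\<integral>\<^sup>+x. (\<integral>\<^sup>+r. ennreal (exp (- r)) * indicator {c * g x..} r * indicator A x \<partial>lborel) \<partial>M)"
    using tail[of "c * g x" for x] by (simp add: nn_integral_multc)
  also have "\<dots> = (\<integral>\<^sup>+r. (\<integral>\<^sup>+x. ennreal (exp (- r)) * indicator {c * g x..} r * indicator A x \<partial>M) \<partial>lborel)"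
  proof -
    have "Measurable.pred (M \<Otimes>\<^sub>M lborel) (\<lambda>(x, r). r \<in> {c * g x..})"
      by simp measurable
    then have [measurable]: "(\<lambda>(x, r). indicator {c * g x..} r :: ennreal) \<in> borel_measurable (M \<Otimes>\<^sub>M lborel)"
      by (simp add: split_beta' indicator_def)
    show ?thesis
      by (subst Fubini') (simp_all add: split_beta')
  qed
  also have "\<dots> \<le> (\<integral>\<^sup>+r. ennreal (V / c ^ k) * (ennreal (r ^ k * exp (- r)) * indicator {0..} r) \<partial>lborel)"
  proof (rule nn_integral_mono)
    fix r :: real
    have "(\<integral>\<^sup>+x. ennreal (exp (- r)) * indicator {c * g x..} r * indicator A x \<partial>M)
        = (\<integral>\<^sup>+x. ennreal (exp (- r)) * indicator {x \<in> A. g x \<le> r / c} x \<partial>M)"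
      using c by (intro nn_integral_cong) (auto simp: field_simps split: split_indicator)
    also have "\<dots> = ennreal (exp (- r)) * emeasure M {x \<in> A. g x \<le> r / c}"
    proof -
      have "{x \<in> A. g x \<le> r / c} = A \<inter> {x \<in> space M. g x \<le> r / c}"
        using A by auto
      then have "{x \<in> A. g x \<le> r / c} \<in> sets M"
        by simp
      then show ?thesis
        by (simp add: nn_integral_cmult)
    qed
    also have "\<dots> \<le> ennreal (V / c ^ k) * (ennreal (r ^ k * exp (- r)) * indicator {0..} r)"
    proof (cases "0 \<le> r")
      case True
      then have "ennreal (exp (- r)) * emeasure M {x \<in> A. g x \<le> r / c}
          \<le> ennreal (exp (- r)) * ennreal (V * (r / c) ^ k)"
        using c by (intro mult_left_mono vol) auto
      also have "\<dots> = ennreal (V / c ^ k) * ennreal (r ^ k * exp (- r))"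
        using c V True by (simp add: power_divide ac_simps flip: ennreal_mult)
      finally show ?thesis
        using True by simp
    next
      case False
      then have "r / c < 0"
        using c by (simp add: divide_neg_pos)
      then have empty: "{x \<in> A. g x \<le> r / c} = {}"
        using g by force
      show ?thesis
        by (simp only: empty emeasure_empty mult_zero_right zero_le)
    qed
    finally show "(\<integral>\<^sup>+x. ennreal (exp (- r)) * indicator {c * g x..} r * indicator A x \<partial>M) \<le> \<dots>" .
  qed
  also have "\<dots> = ennreal (V / c ^ k) * (\<integral>\<^sup>+r. ennreal (r ^ k * exp (- r)) * indicator {0..} r \<partial>lborel)"
    by (rule nn_integral_cmult) measurable
  also have "\<dots> = ennreal (V * fact k / c ^ k)"
    using c V by (simp add: nn_intergal_power_times_exp_Ici flip: ennreal_mult)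
  finally show ?thesis .
qed

text \<open>The decay rate \<open>c * sqrt l\<close> produces the power \<open>- k / (2p)\<close> of \<open>l\<close>. For \<open>p = \<infinity>\<close> the rate \<open>c = 0\<close> has
  to be admitted: the weight below degenerates to 1 when \<open>p = q = \<infinity>\<close>.\<close>

lemma Lp_norm_exp_sublevel:
  assumes M: "sigma_finite_measure M"
    and meas [measurable]: "g \<in> borel_measurable M" "A \<in> sets M"
    and g: "\<And>x. x \<in> A \<Longrightarrow> 0 \<le> g x"
    and vol: "\<And>r. 0 \<le> r \<Longrightarrow> emeasure M {x \<in> A. g x \<le> r} \<le> ennreal (V * r ^ k)"
    and V: "0 \<le> V" and p: "1 \<le> p" and c: "0 \<le> c" "p \<noteq> top \<Longrightarrow> 0 < c"
  shows "\<exists>K>0. \<forall>l\<ge>1. Lp_norm M p (\<lambda>x. indicator A x * ennreal (exp (- (c * sqrt l) * g x)))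
           \<le> ennreal (K * l powr (- (real k / 2 * rcp p)))"
  using p
proof (cases p rule: exponent_cases)
  case 1
  have "esssup M (\<lambda>x. indicator A x * ennreal (exp (- (c * sqrt l) * g x))) \<le> 1" if "1 \<le> l" for l
    using g c that by (intro esssup_I AE_I2) (auto split: split_indicator)
  then show ?thesis
    using 1 by (intro exI[of _ 1]) (auto simp: Lp_norm_top)
next
  case (2 P)
  with c have c: "0 < c" by simp
  \<comment> \<open>The summand 1 keeps the constant positive when the volume bound vanishes.\<close>
  define K where "K = ((V * fact k + 1) * (P * c) powr (- real k)) powr (1 / P)"
  have "Lp_norm M p (\<lambda>x. indicator A x * ennreal (exp (- (c * sqrt l) * g x)))
      \<le> ennreal (K * l powr (- (real k / 2 * rcp p)))" if l: "1 \<le> l" for l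
  proof -
    have e: "epow (indicator A x * ennreal (exp (- (c * sqrt l) * g x))) P
        = ennreal (exp (- (P * c * sqrt l) * g x)) * indicator A x" for x
      using 2 by (auto simp: epow_ennreal exp_powr_real ac_simps split: split_indicator)
    have "Lp_norm M p (\<lambda>x. indicator A x * ennreal (exp (- (c * sqrt l) * g x)))
        = epow (\<integral>\<^sup>+x\<in>A. ennreal (exp (- (P * c * sqrt l) * g x)) \<partial>M) (1 / P)"
      using 2 by (simp only: Lp_norm_ennreal e)
    also have "\<dots> \<le> epow (ennreal (V * fact k / (P * c * sqrt l) ^ k)) (1 / P)"
      using 2 c l by (intro epow_mono nn_integral_exp_sublevel M meas g vol V) auto
    also have "\<dots> \<le> epow (ennreal ((V * fact k + 1) * (P * c * sqrt l) powr (- real k))) (1 / P)"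
      using 2 c l V
      by (intro epow_mono ennreal_leI)
        (auto simp: powr_minus powr_realpow divide_inverse intro!: mult_right_mono)
    also have "(P * c * sqrt l) powr (- real k) = (P * c) powr (- real k) * l powr (- (real k / 2))"
      using l by (simp add: powr_mult powr_half_sqrt[symmetric] powr_powr)
    also have "epow (ennreal ((V * fact k + 1) * ((P * c) powr (- real k) * l powr (- (real k / 2))))) (1 / P)
        = ennreal (K * l powr (- (real k / 2 * rcp p)))"
      using V l 2 by (subst epow_ennreal) (simp_all add: K_def powr_mult powr_powr mult.assoc)
    finally show ?thesis .
  qed
  moreover have "0 < V * fact k + 1"
    using V by (intro add_nonneg_pos) auto
  then have "0 < K"
    using c 2 by (simp add: K_def)
  ultimately show ?thesis by blast
qed

lemma Lp_norm_exp_norm: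
  assumes p: "1 \<le> p" and c: "0 \<le> c" "p \<noteq> top \<Longrightarrow> 0 < c"
  shows "\<exists>K>0. \<forall>l\<ge>1. Lp_norm lborel p (\<lambda>x :: 'a::euclidean_space. ennreal (exp (- (c * sqrt l) * norm x)))
           \<le> ennreal (K * l powr (- (real DIM('a) / 2 * rcp p)))"
proof -
  have "{x :: 'a. norm x \<le> r} = cball 0 r" for r
    by auto
  then show ?thesis
    using Lp_norm_exp_sublevel[of lborel "norm :: 'a \<Rightarrow> real" UNIV "unit_ball_vol (real DIM('a))" "DIM('a)" p c] assms
    by (auto simp: emeasure_cball lborel.sigma_finite_measure_axioms)
qed

lemma Lp_norm_exp_sqrt:
  assumes p: "1 \<le> p" and c: "0 \<le> c" "p \<noteq> top \<Longrightarrow> 0 < c"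
  shows "\<exists>K>0. \<forall>l\<ge>1. Lp_norm lborel p (\<lambda>t :: real. indicator {0..} t * ennreal (exp (- (c * sqrt l) * sqrt t)))
           \<le> ennreal (K * l powr (- rcp p))"
proof -
  have "{t \<in> {0..}. sqrt t \<le> r} = {0..r\<^sup>2}" if "0 \<le> r" for r
    using that by (auto simp: real_sqrt_le_iff' real_le_lsqrt sqrt_le_D)
  then show ?thesis
    using Lp_norm_exp_sublevel[of lborel sqrt "{0..}" 1 2 p c] assms
    by (auto simp: lborel.sigma_finite_measure_axioms)
qed

section \<open>Mixed norms on the half-space\<close>

lemma Lp_norm_product:
  assumes N: "sigma_finite_measure N"
    and rs: "1 \<le> r" "1 \<le> s" and [measurable]: "E \<in> borel_measurable M" "F \<in> borel_measurable N"
  shows "Lp_norm M r (\<lambda>a. Lp_norm N s (\<lambda>b. E a * F b)) \<le> Lp_norm M r E * Lp_norm N s F"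
proof -
  have "Lp_norm M r (\<lambda>a. Lp_norm N s (\<lambda>b. E a * F b)) \<le> Lp_norm M r (\<lambda>a. E a * Lp_norm N s F)"
    using assms by (intro Lp_norm_mono Lp_norm_cmult measurable_Lp_norm N) measurable
  also have "\<dots> \<le> Lp_norm M r E * Lp_norm N s F"
    using Lp_norm_cmult[of r E M "Lp_norm N s F"] assms by (simp add: mult.commute)
  finally show ?thesis .
qed

text \<open>Whichever of \<open>p\<close>, \<open>q\<close> is larger belongs to the inner norm, so the two-variable inequality applies with
  time outermost if \<open>q \<le> p\<close> and with space outermost otherwise. Functions are extended by 0 off the
  half-space; this is compatible with the shift by \<open>z\<close> since the half-space is closed under addition.\<close>

lemma mixed_norm_convolution:
  fixes U w f :: "'n::finite spacetime \<Rightarrow> ennreal"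
  assumes pq: "1 \<le> p" "1 \<le> q"
    and U_meas [measurable]: "U \<in> borel_measurable borel"
    and w_meas [measurable]: "w \<in> borel_measurable borel"
    and f_meas [measurable]: "f \<in> borel_measurable borel"
    and U: "\<And>z. z \<in> half_space \<Longrightarrow> U z \<le> C * mixed_norm p q half_space (\<lambda>y. w y * f (z + y))"
  shows "mixed_norm p q half_space U \<le> C * (mixed_norm p q half_space w * mixed_norm p q half_space f)"
proof -
  let ?H = "half_space :: 'n spacetime set"
  let ?i = "\<lambda>u (z :: 'n spacetime). indicator ?H z * (u z :: ennreal)"
  have H[measurable]: "?H \<in> sets (borel \<Otimes>\<^sub>M borel)"
    by (simp add: half_space_def)
  have [measurable]: "U \<in> borel_measurable (borel \<Otimes>\<^sub>M borel)" "w \<in> borel_measurable (borel \<Otimes>\<^sub>M borel)"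
    "f \<in> borel_measurable (borel \<Otimes>\<^sub>M borel)"
    using U_meas w_meas f_meas by (simp_all add: borel_prod)
  have shift: "indicator ?H y * (w y * f (z + y)) = ?i w y * ?i f (z + y)" if "z \<in> ?H" for z y
    using that by (auto simp: half_space_def split: split_indicator)
  have bound: "?i U z \<le> C * mixed_norm p q UNIV (\<lambda>y. ?i w y * ?i f (z + y))" for z
    using U[of z] by (cases "z \<in> ?H") (auto simp: mixed_norm_def shift)
  show ?thesis
  proof (cases "q \<le> p")
    case True
    have "Lp_norm lborel q (\<lambda>t. Lp_norm lborel p (\<lambda>x. ?i U (t, x)))
        \<le> C * (Lp_norm lborel q (\<lambda>t. Lp_norm lborel p (\<lambda>x. ?i w (t, x))) *
               Lp_norm lborel q (\<lambda>t. Lp_norm lborel p (\<lambda>x. ?i f (t, x))))"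
      using pq True bound[of "(t, x)" for t x]
      by (intro mixed_Lp_convolution) (simp_all add: mixed_norm_def)
    with True show ?thesis
      by (simp add: mixed_norm_def)
  next
    case False
    have "Lp_norm lborel p (\<lambda>x. Lp_norm lborel q (\<lambda>t. ?i U (t, x)))
        \<le> C * (Lp_norm lborel p (\<lambda>x. Lp_norm lborel q (\<lambda>t. ?i w (t, x))) *
               Lp_norm lborel p (\<lambda>x. Lp_norm lborel q (\<lambda>t. ?i f (t, x))))"
      using pq False bound[of "(t, x)" for t x]
      by (intro mixed_Lp_convolution) (simp_all add: mixed_norm_def)
    with False show ?thesis
      by (simp add: mixed_norm_def)
  qed
qed


lemma mixed_norm_mono:
  fixes u v :: "'n::finite spacetime \<Rightarrow> ennreal"
  assumes pq: "1 \<le> p" "1 \<le> q" and u: "u \<in> borel_measurable borel" and Q: "Q \<in> sets borel"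
    and le: "\<And>z. z \<in> Q \<Longrightarrow> u z \<le> v z"
  shows "mixed_norm p q Q u \<le> mixed_norm p q Q v"
proof -
  have [measurable]: "u \<in> borel_measurable (borel \<Otimes>\<^sub>M borel)" "Q \<in> sets (borel \<Otimes>\<^sub>M borel)"
    unfolding borel_prod using u Q by auto
  have "indicator Q z * u z \<le> indicator Q z * v z" for z
    using le[of z] by (auto split: split_indicator)
  then show ?thesis
    using pq unfolding mixed_norm_def
    by (auto intro!: Lp_norm_mono measurable_Lp_norm lborel.sigma_finite_measure_axioms)
qed

lemma mixed_norm_product:
  fixes E :: "real \<Rightarrow> ennreal" and F :: "real^'n::finite \<Rightarrow> ennreal"
  assumes pq: "1 \<le> p" "1 \<le> q"
    and [measurable]: "E \<in> borel_measurable borel" "F \<in> borel_measurable borel"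
  shows "mixed_norm p q half_space (\<lambda>z. E (fst z) * F (snd z))
      \<le> Lp_norm lborel q (\<lambda>t. indicator {0..} t * E t) * Lp_norm lborel p F"
proof -
  note sf = lborel.sigma_finite_measure_axioms
  have H: "indicator half_space (t, x) * (E t * F x) = (indicator {0..} t * E t) * F x" for t and x :: "real^'n"
    by (simp add: half_space_def indicator_times mult.assoc)
  show ?thesis
  proof (cases "q \<le> p")
    case True
    have "Lp_norm lborel q (\<lambda>t. Lp_norm lborel p (\<lambda>x. (indicator {0..} t * E t) * F x))
        \<le> Lp_norm lborel q (\<lambda>t. indicator {0..} t * E t) * Lp_norm lborel p F"
      using pq by (intro Lp_norm_product sf) auto
    with True show ?thesis by (simp add: mixed_norm_def H)
  next
    case False
    have "Lp_norm lborel p (\<lambda>x. Lp_norm lborel q (\<lambda>t. F x * (indicator {0..} t * E t)))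
        \<le> Lp_norm lborel p F * Lp_norm lborel q (\<lambda>t. indicator {0..} t * E t)"
      using pq by (intro Lp_norm_product sf) auto
    with False show ?thesis
      by (simp only: mixed_norm_def fst_conv snd_conv H if_False mult.commute[of "F x" for x] mult.commute[of "Lp_norm lborel p F"])
  qed
qed

lemma mixed_norm_translate:
  fixes h :: "'n::finite spacetime \<Rightarrow> ennreal"
  assumes h: "h \<in> borel_measurable borel" and Q: "Q \<in> sets borel"
    and Q': "\<And>y. y \<in> Q' \<longleftrightarrow> z + y \<in> Q"
  shows "mixed_norm p q Q' (\<lambda>y. h (z + y)) = mixed_norm p q Q h"
proof -
  note sf = lborel.sigma_finite_measure_axioms
  obtain t0 x0 where z: "z = (t0, x0)" by fastforce
  have [measurable]: "h \<in> borel_measurable (borel \<Otimes>\<^sub>M borel)" "Q \<in> sets (borel \<Otimes>\<^sub>M borel)"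
    unfolding borel_prod using h Q by auto
  let ?g = "\<lambda>t x. indicator Q (t, x) * h (t, x)"
  have g: "indicator Q' (t, x) * h (z + (t, x)) = ?g (t0 + t) (x0 + x)" for t x
    using Q'[of "(t, x)"] by (simp add: z indicator_def)
  show ?thesis
  proof (cases "q \<le> p")
    case True
    have "mixed_norm p q Q' (\<lambda>y. h (z + y)) = Lp_norm lborel q (\<lambda>t. Lp_norm lborel p (\<lambda>x. ?g (t0 + t) (x0 + x)))"
      using True by (simp add: mixed_norm_def g)
    also have "\<dots> = Lp_norm lborel q (\<lambda>t. Lp_norm lborel p (?g (t0 + t)))"
      by (subst Lp_norm_translate) simp_all
    also have "\<dots> = Lp_norm lborel q (\<lambda>t. Lp_norm lborel p (?g t))"
      by (rule Lp_norm_translate[of "\<lambda>t. Lp_norm lborel p (?g t)"], rule measurable_Lp_norm[OF sf]) simp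
    finally show ?thesis
      using True by (simp add: mixed_norm_def)
  next
    case False
    have "mixed_norm p q Q' (\<lambda>y. h (z + y)) = Lp_norm lborel p (\<lambda>x. Lp_norm lborel q (\<lambda>t. ?g (t0 + t) (x0 + x)))"
      using False by (simp add: mixed_norm_def g)
    also have "\<dots> = Lp_norm lborel p (\<lambda>x. Lp_norm lborel q (\<lambda>t. ?g t (x0 + x)))"
      by (subst Lp_norm_translate[of "\<lambda>t. ?g t (x0 + x)" for x]) simp_all
    also have "\<dots> = Lp_norm lborel p (\<lambda>x. Lp_norm lborel q (\<lambda>t. ?g t x))"
      by (rule Lp_norm_translate[of "\<lambda>x. Lp_norm lborel q (\<lambda>t. ?g t x)"], rule measurable_Lp_norm[OF sf]) simp
    finally show ?thesis
      using False by (simp add: mixed_norm_def)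
  qed
qed

text \<open>The drift condition bounds the norm over cylinders at all base points, hence is translation
  invariant with the same \<open>bbar\<close>. This makes the estimates for processes started at the origin
  uniform over all starting points.\<close>

lemma drift_bound_translate:
  assumes "drift_bound p0 q0 h bbar"
  shows "drift_bound p0 q0 (\<lambda>y. h (z + y)) bbar"
proof -
  have [measurable]: "h \<in> borel_measurable borel"
    using assms by (simp add: drift_bound_def)
  have "mixed_norm p q (cylinder R w) (\<lambda>y. ennreal (h (z + y)))
      = mixed_norm p q (cylinder R (z + w)) (\<lambda>y. ennreal (h y))" for p q R w
  proof (rule mixed_norm_translate)
    show "cylinder R (z + w) \<in> sets borel"
      unfolding cylinder_def borel_prod[symmetric] by (intro pair_measureI) auto
    show "y \<in> cylinder R w \<longleftrightarrow> z + y \<in> cylinder R (z + w)" for y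
      by (cases y; cases z; cases w) (auto simp: cylinder_def dist_norm)
  qed simp
  then show ?thesis
    using assms unfolding drift_bound_def by (simp del: split_paired_All)
qed

text \<open>For \<open>l \<ge> 1\<close> the rate in \<open>Psi\<close> is at least a multiple of \<open>sqrt l\<close>, so the weight is at most a product of an
  exponential in \<open>sqrt t\<close> and one in \<open>norm x\<close>, whose norms scale like \<open>l\<close> to the powers \<open>- 1/q\<close> and \<open>- d/(2p)\<close>.
  The exponent \<open>1 - nu = d0/p + 1/q\<close> is positive unless \<open>p = q = \<infinity>\<close>, so the weight
  decays whenever one of the two exponents is finite.\<close>

lemma mixed_norm_Psi:
  assumes pq: "1 \<le> p" "1 \<le> q" and d0: "0 < d0" and R: "0 < Rlow" and xi0: "0 < xi0"
  shows "\<exists>K>0. \<forall>l\<ge>1. mixed_norm p q half_space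
             (\<lambda>z :: 'n::finite spacetime. ennreal (Psi xi0 Rlow l z powr (1 - nu d0 p q)))
           \<le> ennreal (K * l powr (- (real CARD('n) / 2 * rcp p) - rcp q))"
proof -
  define a where "a = 1 - nu d0 p q"
  have rcp: "0 \<le> rcp r" "r \<noteq> top \<Longrightarrow> 0 < rcp r" if "1 \<le> r" for r
    using that by (cases r rule: exponent_cases; simp)+
  have a: "0 \<le> a" "p \<noteq> top \<Longrightarrow> 0 < a" "q \<noteq> top \<Longrightarrow> 0 < a"
    using rcp[OF pq(1)] rcp[OF pq(2)] d0 by (auto simp: a_def nu_def add_pos_nonneg add_nonneg_pos)
  define c where "c = a * min 1 Rlow * xi0 / 16"
  have c: "0 \<le> c" "p \<noteq> top \<Longrightarrow> 0 < c" "q \<noteq> top \<Longrightarrow> 0 < c"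
    using a R xi0 by (auto simp: c_def)
  obtain K1 where K1: "K1 > 0" "\<And>l. 1 \<le> l \<Longrightarrow>
      Lp_norm lborel p (\<lambda>x :: real^'n. ennreal (exp (- (c * sqrt l) * norm x)))
        \<le> ennreal (K1 * l powr (- (real CARD('n) / 2 * rcp p)))"
    using Lp_norm_exp_norm[where 'a = "real^'n", OF pq(1) c(1,2)] by (auto simp: DIM_cart)
  obtain K2 where K2: "K2 > 0" "\<And>l. 1 \<le> l \<Longrightarrow>
      Lp_norm lborel q (\<lambda>t :: real. indicator {0..} t * ennreal (exp (- (c * sqrt l) * sqrt t)))
        \<le> ennreal (K2 * l powr (- rcp q))"
    using Lp_norm_exp_sqrt[OF pq(2) c(1,3)] by auto
  have "mixed_norm p q half_space (\<lambda>z :: 'n spacetime. ennreal (Psi xi0 Rlow l z powr a))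
      \<le> ennreal (K2 * K1 * l powr (- (real CARD('n) / 2 * rcp p) - rcp q))" if l: "1 \<le> l" for l
  proof -
    have "sqrt l * min 1 Rlow = sqrt (l * (min 1 Rlow)\<^sup>2)"
      using R by (simp add: real_sqrt_mult)
    also have "\<dots> \<le> sqrt (lam_dot Rlow l)"
    proof -
      have "(min 1 Rlow)\<^sup>2 \<le> min 1 (l * Rlow\<^sup>2)"
      proof -
        have "(min 1 Rlow)\<^sup>2 \<le> 1\<^sup>2" "(min 1 Rlow)\<^sup>2 \<le> Rlow\<^sup>2"
          using R by (intro power_mono; simp)+
        moreover have "Rlow\<^sup>2 \<le> l * Rlow\<^sup>2"
          using l by (simp add: mult_le_cancel_right1)
        ultimately show ?thesis by simp
      qed
      then show ?thesis
        using l by (simp add: lam_dot_def)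
    qed
    finally have rate: "c * sqrt l \<le> a * sqrt (lam_dot Rlow l) * xi0 / 16"
      using a xi0 by (simp add: c_def ac_simps mult_left_mono)
    have "mixed_norm p q half_space (\<lambda>z :: 'n spacetime. ennreal (Psi xi0 Rlow l z powr a))
        \<le> mixed_norm p q half_space (\<lambda>z :: 'n spacetime.
            ennreal (exp (- (c * sqrt l) * sqrt (fst z))) * ennreal (exp (- (c * sqrt l) * norm (snd z))))"
    proof (rule mixed_norm_mono[OF pq])
      fix z :: "'n spacetime" assume "z \<in> half_space"
      then have "0 \<le> norm (snd z) + sqrt (fst z)"
        by (auto simp: half_space_def)
      with rate have "c * sqrt l * (norm (snd z) + sqrt (fst z))
          \<le> a * sqrt (lam_dot Rlow l) * xi0 / 16 * (norm (snd z) + sqrt (fst z))"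
        by (rule mult_right_mono)
      then have "exp (- (a * sqrt (lam_dot Rlow l) * xi0 / 16 * (norm (snd z) + sqrt (fst z))))
          \<le> exp (- (c * sqrt l * (norm (snd z) + sqrt (fst z))))"
        by simp
      also have "\<dots> = exp (- (c * sqrt l) * sqrt (fst z)) * exp (- (c * sqrt l) * norm (snd z))"
        by (simp add: algebra_simps flip: exp_add)
      also have "exp (- (a * sqrt (lam_dot Rlow l) * xi0 / 16 * (norm (snd z) + sqrt (fst z))))
          = Psi xi0 Rlow l z powr a"
        by (simp add: Psi_def exp_powr_real ac_simps)
      finally show "ennreal (Psi xi0 Rlow l z powr a)
          \<le> ennreal (exp (- (c * sqrt l) * sqrt (fst z))) * ennreal (exp (- (c * sqrt l) * norm (snd z)))"
        by (simp flip: ennreal_mult)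
    next
      show "(half_space :: 'n spacetime set) \<in> sets borel"
        unfolding half_space_def borel_prod[symmetric] by (intro pair_measureI) auto
      show "(\<lambda>z :: 'n spacetime. ennreal (Psi xi0 Rlow l z powr a)) \<in> borel_measurable borel"
        unfolding Psi_def borel_prod[symmetric] by measurable
    qed
    also have "\<dots> \<le> Lp_norm lborel q (\<lambda>t :: real. indicator {0..} t * ennreal (exp (- (c * sqrt l) * sqrt t)))
        * Lp_norm lborel p (\<lambda>x :: real^'n. ennreal (exp (- (c * sqrt l) * norm x)))"
      by (intro mixed_norm_product pq) measurable
    also have "\<dots> \<le> ennreal (K2 * l powr (- rcp q)) * ennreal (K1 * l powr (- (real CARD('n) / 2 * rcp p)))"
      by (intro mult_mono K1 K2 l) auto
    also have "\<dots> = ennreal ((K2 * l powr (- rcp q)) * (K1 * l powr (- (real CARD('n) / 2 * rcp p))))"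
      using K1 K2 by (simp add: ennreal_mult)
    also have "(K2 * l powr (- rcp q)) * (K1 * l powr (- (real CARD('n) / 2 * rcp p)))
        = K2 * K1 * l powr (- (real CARD('n) / 2 * rcp p) - rcp q)"
      using powr_add[of l "- (real CARD('n) / 2 * rcp p)" "- rcp q"] by simp
    finally show ?thesis .
  qed
  moreover have "0 < K2 * K1" using K1 K2 by simp
  ultimately show ?thesis unfolding a_def by blast
qed

section \<open>Measurability of the resolvent\<close>

text \<open>The process is the limit of its values at the grid times \<open>\<lfloor>n s\<rfloor> / n\<close>, and each of these
  approximations glues countably many measurable functions. The time \<open>max 0 s\<close> avoids restricting the
  time measure to the half-line.\<close>

lemma measurable_continuous_process:
  fixes X :: "real \<Rightarrow> 'w \<Rightarrow> 'b::metric_space"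
  assumes X: "\<And>s. 0 \<le> s \<Longrightarrow> X s \<in> borel_measurable M"
    and cont: "\<And>w. w \<in> space M \<Longrightarrow> continuous_on {0..} (\<lambda>s. X s w)"
  shows "(\<lambda>(w, s). X (max 0 s) w) \<in> borel_measurable (M \<Otimes>\<^sub>M borel)"
proof -
  define r where "r n s = real (nat \<lfloor>real (Suc n) * max 0 s\<rfloor>) / real (Suc n)" for n and s :: real
  have r_lim: "(\<lambda>n. r n s) \<longlonglongrightarrow> max 0 s" for s
  proof (rule tendsto_sandwich[OF always_eventually always_eventually])
    show "\<forall>n. max 0 s - 1 / real (Suc n) \<le> r n s" "\<forall>n. r n s \<le> max 0 s"
    proof safe
      fix n
      have "0 \<le> real (Suc n) * max 0 s" by simp
      then have "real (Suc n) * max 0 s - 1 \<le> real (nat \<lfloor>real (Suc n) * max 0 s\<rfloor>)"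
        "real (nat \<lfloor>real (Suc n) * max 0 s\<rfloor>) \<le> real (Suc n) * max 0 s"
        by linarith+
      from this[THEN divide_right_mono, of "real (Suc n)"]
      show "max 0 s - 1 / real (Suc n) \<le> r n s" "r n s \<le> max 0 s"
        unfolding r_def by (simp_all add: diff_divide_distrib del: of_nat_Suc)
    qed
    show "(\<lambda>n. max 0 s - 1 / real (Suc n)) \<longlonglongrightarrow> max 0 s"
      using tendsto_diff[OF tendsto_const LIMSEQ_inverse_real_of_nat, of "max 0 s"]
      by (simp add: inverse_eq_divide)
  qed auto
  show ?thesis
  proof (rule borel_measurable_LIMSEQ_metric)
    fix n
    have "(\<lambda>z. (\<lambda>k z. X (real k / real (Suc n)) (fst z)) (nat \<lfloor>real (Suc n) * max 0 (snd z)\<rfloor>) z)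
        \<in> borel_measurable (M \<Otimes>\<^sub>M borel)"
      by (rule measurable_compose_countable) (intro measurable_compose[OF measurable_fst] X, simp, measurable)
    then show "(\<lambda>z. X (r n (snd z)) (fst z)) \<in> borel_measurable (M \<Otimes>\<^sub>M borel)"
      by (simp add: r_def)
  next
    fix z assume "z \<in> space (M \<Otimes>\<^sub>M (borel :: real measure))"
    then have "continuous_on {0..} (\<lambda>s. X s (fst z))"
      by (auto simp: space_pair_measure intro: cont)
    then have "(\<lambda>n. X (r n (snd z)) (fst z)) \<longlonglongrightarrow> X (max 0 (snd z)) (fst z)"
      by (rule continuous_on_tendsto_compose[OF _ r_lim]) (auto simp: r_def)
    then show "(\<lambda>n. X (r n (snd z)) (fst z)) \<longlonglongrightarrow> (case z of (w, s) \<Rightarrow> X (max 0 s) w)"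
      by (simp add: split_beta')
  qed
qed

lemma measurable_evaluation:
  "0 \<le> s \<Longrightarrow> (\<lambda>\<omega> :: 'n::finite trajectory. \<omega> s) \<in> borel_measurable (path_sigma UNIV)"
proof (rule measurableI)
  fix A :: "'n spacetime set" assume "0 \<le> s" "A \<in> sets borel"
  then show "(\<lambda>\<omega>. \<omega> s) -` A \<inter> space (path_sigma UNIV) \<in> sets (path_sigma UNIV)"
    unfolding path_sigma_def by (subst space_measure_of, blast, subst sets_measure_of, blast) (rule sigma_sets.Basic, blast)
qed auto

lemma space_path_sigma [simp]: "space (path_sigma I) = path_space"
  unfolding path_sigma_def by (rule space_measure_of) blast

lemma measurable_path:
  "(\<lambda>(\<omega> :: 'n::finite trajectory, s). \<omega> (max 0 s)) \<in> borel_measurable (path_sigma UNIV \<Otimes>\<^sub>M borel)"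
  by (rule measurable_continuous_process[where X = "\<lambda>s \<omega>. \<omega> s"])
    (auto intro: measurable_evaluation simp: path_space_def)

lemma markov_processD:
  assumes "markov_process F P"
  shows "prob_space (P z)" "space (P z) = path_space" "sets (P z) = sets (path_sigma UNIV)"
    "0 \<le> s \<Longrightarrow> A \<in> sets borel \<Longrightarrow>
       (\<lambda>z. measure (P z) {\<omega> \<in> path_space. \<omega> s \<in> A}) \<in> borel_measurable borel"
  using assms unfolding markov_process_def by blast+

text \<open>A Markov process is only required to have transition probabilities that are measurable in the
  starting point for each fixed time. Joint measurability in time follows from path continuity: for
  bounded continuous \<open>g\<close> the expectation of \<open>g (\<omega> s)\<close> is continuous in \<open>s\<close>, and the indicator of an open
  set is a limit of such \<open>g\<close>; open sets generate the Borel sets.\<close>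

lemma markov_transition_kernel:
  assumes "markov_process F (P :: 'n::finite spacetime \<Rightarrow> _)"
  shows "(\<lambda>(z, s). distr (P z) borel (\<lambda>\<omega>. \<omega> (max 0 s))) \<in> borel \<Otimes>\<^sub>M borel \<rightarrow>\<^sub>M subprob_algebra borel"
proof -
  note P = markov_processD(1-3)[OF assms] and P_meas = markov_processD(4)[OF assms]
  define law where "law s z = distr (P z) borel (\<lambda>\<omega>. \<omega> s)" for s z
  have ev[measurable]: "(\<lambda>\<omega>. \<omega> s) \<in> borel_measurable (P z)" if "0 \<le> s" for s z
    using measurable_evaluation[OF that] measurable_cong_sets[OF P(3) refl] by blast
  have law_prob: "prob_space (law s z)" if "0 \<le> s" for s z
    unfolding law_def by (intro prob_space.prob_space_distr P ev that)
  have law_fixed: "law s \<in> borel \<rightarrow>\<^sub>M subprob_algebra borel" if s: "0 \<le> s" for s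
  proof (rule measurable_subprob_algebra)
    show "subprob_space (law s z)" for z
      using law_prob[OF s] by (rule prob_space_imp_subprob_space)
    show "sets (law s z) = sets borel" for z
      by (simp add: law_def)
    show "(\<lambda>z. emeasure (law s z) A) \<in> borel_measurable borel" if A: "A \<in> sets borel" for A
    proof -
      have "emeasure (law s z) A = ennreal (measure (P z) {\<omega> \<in> path_space. \<omega> s \<in> A})" for z
      proof -
        interpret prob_space "P z" by (rule P)
        have "emeasure (law s z) A = emeasure (P z) {\<omega> \<in> path_space. \<omega> s \<in> A}"
          unfolding law_def using A ev[OF s]
          by (subst emeasure_distr) (auto simp: P intro!: arg_cong[where f = "emeasure (P z)"])
        then show ?thesis
          by (simp add: emeasure_eq_measure)
      qed
      then show ?thesis
        using P_meas[OF s A] by simp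
    qed
  qed
  have expect: "(\<lambda>(z, s). \<integral>y. g y \<partial>law (max 0 s) z) \<in> borel_measurable (borel \<Otimes>\<^sub>M borel)"
    if g: "continuous_on UNIV g" "\<And>y. \<bar>g y\<bar> \<le> 1" for g :: "'n spacetime \<Rightarrow> real"
  proof (rule measurable_continuous_process[where X = "\<lambda>s z. \<integral>y. g y \<partial>law s z"])
    have [measurable]: "g \<in> borel_measurable borel"
      using g(1) by (rule borel_measurable_continuous_onI)
    show "(\<lambda>z. \<integral>y. g y \<partial>law s z) \<in> borel_measurable borel" if "0 \<le> s" for s
      by (rule measurable_compose[OF law_fixed[OF that]]) measurable
    show "continuous_on {0..} (\<lambda>s. \<integral>y. g y \<partial>law s z)" for z
    proof -
      interpret prob_space "P z" by (rule P)
      have "continuous_on {0..} (\<lambda>s. \<integral>\<omega>. g (\<omega> s) \<partial>P z)"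
        unfolding continuous_on_sequentially
      proof (intro allI ballI impI)
        fix r and s :: real
        assume s: "s \<in> {0..}" and "(\<forall>n. r n \<in> {0..}) \<and> r \<longlonglongrightarrow> s"
        then have r: "\<forall>n. r n \<in> {0..}" and lim: "r \<longlonglongrightarrow> s" by auto
        show "((\<lambda>s. \<integral>\<omega>. g (\<omega> s) \<partial>P z) \<circ> r) \<longlonglongrightarrow> (\<integral>\<omega>. g (\<omega> s) \<partial>P z)"
          unfolding o_def
        proof (rule integral_dominated_convergence[where w = "\<lambda>_. 1"])
          show "(\<lambda>\<omega>. g (\<omega> s)) \<in> borel_measurable (P z)"
            using s by (intro measurable_compose[OF ev]) auto
          show "(\<lambda>\<omega>. g (\<omega> (r n))) \<in> borel_measurable (P z)" for n
            using r by (intro measurable_compose[OF ev]) auto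
          show "AE \<omega> in P z. (\<lambda>n. g (\<omega> (r n))) \<longlonglongrightarrow> g (\<omega> s)"
          proof (rule AE_I2)
            fix \<omega> assume "\<omega> \<in> space (P z)"
            then have "continuous_on {0..} \<omega>"
              by (auto simp: P path_space_def)
            then have "(\<lambda>n. \<omega> (r n)) \<longlonglongrightarrow> \<omega> s"
              using r s by (intro continuous_on_tendsto_compose[OF _ lim]) auto
            then show "(\<lambda>n. g (\<omega> (r n))) \<longlonglongrightarrow> g (\<omega> s)"
              by (intro continuous_on_tendsto_compose[OF g(1)]) auto
          qed
        qed (use g in auto)
      qed
      also have "continuous_on {0..} (\<lambda>s. \<integral>\<omega>. g (\<omega> s) \<partial>P z) \<longleftrightarrow> continuous_on {0..} (\<lambda>s. \<integral>y. g y \<partial>law s z)"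
        unfolding law_def by (intro continuous_on_cong refl, subst integral_distr) (auto intro: ev)
      finally show ?thesis .
    qed
  qed
  have "(\<lambda>(z, s). law (max 0 s) z) \<in> borel \<Otimes>\<^sub>M borel \<rightarrow>\<^sub>M subprob_algebra borel"
  proof (rule measurable_subprob_algebra_generated[where \<Omega> = UNIV and G = "Collect open"])
    show "sets borel = sigma_sets UNIV (Collect open)"
      by (simp add: borel_def)
    show "Int_stable (Collect open)"
      by (auto simp: Int_stable_def)
    have prob: "prob_space (law (max 0 s) z)" for s z
      by (rule law_prob) simp
    show "subprob_space (case a of (z, s) \<Rightarrow> law (max 0 s) z)" for a
      by (auto intro: prob_space_imp_subprob_space prob split: prod.split)
    show "sets (case a of (z, s) \<Rightarrow> law (max 0 s) z) = sets borel" for a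
      by (auto simp: law_def split: prod.split)
    have borel_law: "borel_measurable (law s z) = borel_measurable borel" for s z
      by (intro measurable_cong_sets) (simp_all add: law_def)
    have "emeasure (law (max 0 s) z) UNIV = 1" for s z
      using prob_space.emeasure_space_1[OF prob[of s z]] by (simp add: law_def)
    then show "(\<lambda>a. emeasure (case a of (z, s) \<Rightarrow> law (max 0 s) z) UNIV) \<in> borel_measurable (borel \<Otimes>\<^sub>M borel)"
      by (simp add: split_beta')
    fix A :: "'n spacetime set" assume "A \<in> Collect open"
    then have A: "open A" by simp
    show "(\<lambda>a. emeasure (case a of (z, s) \<Rightarrow> law (max 0 s) z) A) \<in> borel_measurable (borel \<Otimes>\<^sub>M borel)"
    proof (cases "A = UNIV")
      case True
      with \<open>\<And>z s. emeasure (law (max 0 s) z) UNIV = 1\<close> show ?thesis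
        by (simp add: split_beta')
    next
      case False
      then have ne: "- A \<noteq> {}" by auto
      define g where "g n y = min 1 (real n * infdist y (- A))" for n y
      have g_cont: "continuous_on UNIV (g n)" for n
        unfolding g_def by (intro continuous_intros)
      have g_bound: "\<bar>g n y\<bar> \<le> 1" for n y
        by (auto simp: g_def infdist_nonneg)
      have g_lim: "(\<lambda>n. g n y) \<longlonglongrightarrow> indicator A y" for y
      proof (cases "y \<in> A")
        case True
        then have pos: "0 < infdist y (- A)"
          using A ne in_closed_iff_infdist_zero[of "- A" y] infdist_nonneg[of y "- A"]
          by (auto simp: closed_Compl)
        then obtain n0 where n0: "1 / infdist y (- A) < real n0"
          using reals_Archimedean2 by blast
        have "g n y = 1" if "n0 \<le> n" for n
        proof -
          have "1 / infdist y (- A) < real n" using n0 that by linarith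
          then show ?thesis using pos by (simp add: g_def field_simps)
        qed
        then show ?thesis
          using True by (intro tendsto_eventually) (auto simp: eventually_sequentially)
      next
        case False
        then show ?thesis by (simp add: g_def)
      qed
      have "(\<lambda>(z, s). measure (law (max 0 s) z) A) \<in> borel_measurable (borel \<Otimes>\<^sub>M borel)"
      proof (rule borel_measurable_LIMSEQ_metric)
        show "(\<lambda>(z, s). \<integral>y. g n y \<partial>law (max 0 s) z) \<in> borel_measurable (borel \<Otimes>\<^sub>M borel)" for n
          by (rule expect[OF g_cont g_bound])
        fix a :: "'n spacetime \<times> real"
        obtain z s where a: "a = (z, s)" by fastforce
        interpret prob_space "law (max 0 s) z" by (rule prob)
        have [measurable]: "A \<in> sets borel" "\<And>n. g n \<in> borel_measurable borel"
          using A g_cont by (auto intro: borel_measurable_continuous_onI)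
        have "(\<lambda>n. \<integral>y. g n y \<partial>law (max 0 s) z) \<longlonglongrightarrow> (\<integral>y. indicator A y \<partial>law (max 0 s) z)"
          by (rule integral_dominated_convergence[where w = "\<lambda>_. 1"])
            (simp_all add: borel_law g_lim g_bound)
        then show "(\<lambda>n. case a of (z, s) \<Rightarrow> \<integral>y. g n y \<partial>law (max 0 s) z)
            \<longlonglongrightarrow> (case a of (z, s) \<Rightarrow> measure (law (max 0 s) z) A)"
          using A by (simp add: a law_def)
      qed
      moreover have "emeasure (case a of (z, s) \<Rightarrow> law (max 0 s) z) A
          = ennreal (case a of (z, s) \<Rightarrow> measure (law (max 0 s) z) A)" for a
        by (auto intro!: finite_measure.emeasure_eq_measure prob_space.finite_measure prob split: prod.split)
      ultimately show ?thesis by simp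
    qed
  qed auto
  then show ?thesis
    by (simp add: law_def)
qed

text \<open>Because the time component of a path is almost surely the deterministic clock, the integrand is a
  function of \<open>\<omega> s\<close> alone. By Tonelli the resolvent is then an integral against the jointly measurable
  transition kernel.\<close>

lemma measurable_resolvent:
  fixes P :: "'n::finite spacetime \<Rightarrow> 'n trajectory measure"
  assumes P: "markov_process F P" and f: "nonneg_borel f"
    and clock: "\<And>z. AE \<omega> in P z. \<forall>s\<ge>0. fst (\<omega> s) = fst z + s"
  shows "resolvent l P f \<in> borel_measurable borel"
proof -
  have [measurable]: "f \<in> borel_measurable borel"
    using f by (simp add: nonneg_borel_def)
  define law where "law = (\<lambda>(z, s). distr (P z) borel (\<lambda>\<omega>. \<omega> (max 0 s)))"
  have law[measurable]: "law \<in> borel \<Otimes>\<^sub>M borel \<rightarrow>\<^sub>M subprob_algebra borel"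
    unfolding law_def by (rule markov_transition_kernel[OF P])
  have "resolvent l P f z = (\<integral>\<^sup>+s. (\<integral>\<^sup>+y. ennreal (exp (- l * s) * f y) * indicator {0..} s \<partial>law (z, s)) \<partial>lborel)" for z
  proof -
    interpret prob_space "P z" by (rule markov_processD[OF P])
    note Pz = markov_processD(3)[OF P]
    interpret pair_sigma_finite "P z" lborel ..
    have [measurable]: "(\<lambda>(\<omega>, s). \<omega> (max 0 s)) \<in> borel_measurable (P z \<Otimes>\<^sub>M borel)"
      using measurable_path by (simp cong: measurable_cong_sets add: Pz cong: sets_pair_measure_cong)
    have ev: "(\<lambda>\<omega>. \<omega> (max 0 s)) \<in> borel_measurable (P z)" for s :: real
      using measurable_evaluation[of "max 0 s"] measurable_cong_sets[OF Pz refl] by auto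
    have "resolvent l P f z
        = (\<integral>\<^sup>+\<omega>. (\<integral>\<^sup>+s. ennreal (exp (- l * s) * f (\<omega> (max 0 s))) * indicator {0..} s \<partial>lborel) \<partial>P z)"
      unfolding resolvent_def using clock[of z]
    proof (intro nn_integral_cong_AE, eventually_elim, intro nn_integral_cong)
      fix \<omega> :: "'n trajectory" and s :: real
      assume *: "\<forall>s\<ge>0. fst (\<omega> s) = fst z + s"
      show "ennreal (exp (- l * s) * f (fst z + s, snd (\<omega> s))) * indicator {0..} s
          = ennreal (exp (- l * s) * f (\<omega> (max 0 s))) * indicator {0..} s"
        using *[rule_format, of s, symmetric] by (auto simp: max_def split: split_indicator)
    qed
    also have "\<dots> = (\<integral>\<^sup>+s. (\<integral>\<^sup>+\<omega>. ennreal (exp (- l * s) * f (\<omega> (max 0 s))) * indicator {0..} s \<partial>P z) \<partial>lborel)"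
      by (rule Fubini'[symmetric]) measurable
    also have "\<dots> = (\<integral>\<^sup>+s. (\<integral>\<^sup>+y. ennreal (exp (- l * s) * f y) * indicator {0..} s \<partial>law (z, s)) \<partial>lborel)"
      unfolding law_def by (simp add: nn_integral_distr[OF ev])
    finally show ?thesis .
  qed
  moreover have "(\<lambda>z. \<integral>\<^sup>+s. (\<integral>\<^sup>+y. ennreal (exp (- l * s) * f y) * indicator {0..} s \<partial>law (z, s)) \<partial>lborel)
      \<in> borel_measurable borel"
  proof (rule lborel.borel_measurable_nn_integral)
    have "(\<lambda>a. \<integral>\<^sup>+y. ennreal (exp (- l * snd a) * f y) * indicator {0..} (snd a) \<partial>law a)
        \<in> borel_measurable (borel \<Otimes>\<^sub>M borel)"
      by (rule nn_integral_measurable_subprob_algebra2[OF _ law]) measurable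
    then show "(\<lambda>(z, s). \<integral>\<^sup>+y. ennreal (exp (- l * s) * f y) * indicator {0..} s \<partial>law (z, s))
        \<in> borel_measurable (borel \<Otimes>\<^sub>M lborel)"
      by (simp add: split_beta' cong: measurable_cong_sets sets_pair_measure_cong)
  qed
  ultimately show ?thesis
    by (simp cong: measurable_cong)
qed

section \<open>The resolvent estimate\<close>

lemma markov_diffusion_clock:
  assumes "markov_diffusion \<sigma> b P"
  shows "AE \<omega> in P z. \<forall>s\<ge>0. fst (\<omega> s) = fst z + s"
proof -
  obtain t x where z: "z = (t, x)" by fastforce
  show ?thesis
    using assms unfolding markov_diffusion_def AE_completion_iff z fst_conv by blast
qed

lemma markov_diffusion_diffusion_type:
  fixes P :: "'n::finite spacetime \<Rightarrow> 'n trajectory measure"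
  assumes P: "markov_diffusion \<sigma> b P" and h: "drift_bound p0 q0 h bbar"
    and \<sigma>: "\<And>z. \<sigma> z \<in> S_delta \<delta>" and b: "\<And>z. norm (b z) \<le> h z"
  shows "diffusion_type \<delta> p0 q0 (\<lambda>y. h (z + y)) bbar (completion (P z)) (\<lambda>s \<omega>. snd (\<omega> s) - snd z)"
proof -
  obtain t x where z: "z = (t, x)" by fastforce
  from P obtain w where "ito_process (completion (P (t, x))) (completed_filtration (P (t, x)) Nfil) w
      (\<lambda>s \<omega>. \<sigma> (t + s, snd (\<omega> s))) (\<lambda>s \<omega>. b (t + s, snd (\<omega> s))) (\<lambda>s \<omega>. snd (\<omega> s) - x)"
    unfolding markov_diffusion_def by blast
  then have "ito_process (completion (P z)) (completed_filtration (P z) Nfil) w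
      (\<lambda>s \<omega>. \<sigma> (t + s, snd (\<omega> s))) (\<lambda>s \<omega>. b (t + s, snd (\<omega> s))) (\<lambda>s \<omega>. snd (\<omega> s) - snd z)"
    by (simp add: z)
  moreover have "norm (b (t + s, snd (\<omega> s))) \<le> h (z + (s, snd (\<omega> s) - snd z))"
    for s and \<omega> :: "'n trajectory"
    using b[of "(t + s, snd (\<omega> s))"] by (simp add: z)
  ultimately show ?thesis
    unfolding diffusion_type_def using drift_bound_translate[OF h] \<sigma>
    by (intro conjI exI allI impI ballI) assumption+
qed

lemma resolvent_eq_potential:
  "resolvent l P f z = potential l (completion (P z)) (\<lambda>s \<omega>. snd (\<omega> s) - snd z) (\<lambda>y. f (z + y))"
  by (cases z) (simp add: resolvent_def potential_def nn_integral_completion)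

text \<open>Property (ii) of \<open>d0\<close>. What matters is that \<open>N\<close> is chosen before \<open>h\<close> and the process: the same \<open>N\<close> then
  serves all translates of \<open>h\<close>, that is, all starting points.\<close>

lemma d0_constant_potential_bound:
  fixes xi :: "real \<Rightarrow> real"
  assumes d0: "d0_constant TYPE('n::finite) xi Nbar \<delta> p0 q0 Rlow d0"
    and pq: "1 \<le> p" "1 \<le> q" "nu d0 p q \<ge> 0"
  obtains N where "0 < N"
    "\<And>h bbar (M :: 'n trajectory measure) (x :: real \<Rightarrow> 'n trajectory \<Rightarrow> real^'n) l f.
       diffusion_type \<delta> p0 q0 h bbar M x \<Longrightarrow> Nbar p0 \<delta> * bbar Rlow < 1 \<Longrightarrow> (bbar \<longlongrightarrow> B) at_top \<Longrightarrow>
       0 < l \<Longrightarrow> nonneg_borel f \<Longrightarrow>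
       potential l M x f
         \<le> ennreal (N * lam_ddot (real CARD('n)) d0 l
              powr (- nu d0 p q + (real CARD('n) - 2 * d0) / 2 * rcp p)) *
           mixed_norm p q half_space (\<lambda>z. ennreal (Psi (xi \<delta>) Rlow l z powr (1 - nu d0 p q) * f z))"
proof -
  note d0[unfolded d0_constant_def Let_def, THEN conjunct2, THEN conjunct2, THEN conjunct2, THEN conjunct1,
      THEN spec, of p, THEN spec, of q]
  with pq have "\<exists>N>0. \<forall>h bbar. \<forall>(M :: 'n trajectory measure) (x :: real \<Rightarrow> 'n trajectory \<Rightarrow> real^'n).
      diffusion_type \<delta> p0 q0 h bbar M x \<and> Nbar p0 \<delta> * bbar Rlow < 1 \<and> (bbar \<longlongrightarrow> B) at_top \<longrightarrow>
      (\<forall>l>0. \<forall>f. nonneg_borel f \<longrightarrow>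
         potential l M x f
         \<le> ennreal (N * lam_ddot (real CARD('n)) d0 l
              powr (- nu d0 p q + (real CARD('n) - 2 * d0) / 2 * rcp p)) *
           mixed_norm p q half_space (\<lambda>z. ennreal (Psi (xi \<delta>) Rlow l z powr (1 - nu d0 p q) * f z)))"
    by blast
  then obtain N where N: "0 < N" and *: "\<forall>h bbar. \<forall>(M :: 'n trajectory measure) (x :: real \<Rightarrow> 'n trajectory \<Rightarrow> real^'n).
      diffusion_type \<delta> p0 q0 h bbar M x \<and> Nbar p0 \<delta> * bbar Rlow < 1 \<and> (bbar \<longlongrightarrow> B) at_top \<longrightarrow>
      (\<forall>l>0. \<forall>f. nonneg_borel f \<longrightarrow>
         potential l M x f
         \<le> ennreal (N * lam_ddot (real CARD('n)) d0 l
              powr (- nu d0 p q + (real CARD('n) - 2 * d0) / 2 * rcp p)) *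
           mixed_norm p q half_space (\<lambda>z. ennreal (Psi (xi \<delta>) Rlow l z powr (1 - nu d0 p q) * f z)))"
    by blast
  show thesis
    by (rule that[OF N]) (use * in blast)
qed

theorem theorem4p2:
  fixes xi :: "real \<Rightarrow> real" and Nbar :: "real \<Rightarrow> real \<Rightarrow> real"
    and \<delta> p0 q0 Rlow d0 :: real and p q :: ennreal
  assumes dim: "CARD('n::finite) \<ge> 2"
    and delta: "0 < \<delta>" "\<delta> < 1"
    and exponents: "admissible_exponents TYPE('n) p0 q0"
    and constants: "exit_constants TYPE('n) xi Nbar"
    and Rlow: "0 < Rlow"
    and d0: "d0_constant TYPE('n) xi Nbar \<delta> p0 q0 Rlow d0"
    and pq: "1 \<le> p" "1 \<le> q" "nu d0 p q \<ge> 0"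
  shows "\<forall>B. \<exists>N>0. \<forall>h bbar.
           \<forall>(\<sigma> :: 'n spacetime \<Rightarrow> real^'n^'n) (b :: 'n spacetime \<Rightarrow> real^'n) P.
             drift_bound p0 q0 h bbar \<and> Nbar p0 \<delta> * bbar Rlow < 1 \<and> (bbar \<longlongrightarrow> B) at_top \<and>
             \<sigma> \<in> borel_measurable borel \<and> (\<forall>z. \<sigma> z \<in> S_delta \<delta>) \<and>
             b \<in> borel_measurable borel \<and> (\<forall>z. norm (b z) \<le> h z) \<and>
             markov_diffusion \<sigma> b P \<longrightarrow>
             (\<forall>l\<ge>1. \<forall>f. nonneg_borel f \<longrightarrow>
                mixed_norm p q half_space (resolvent l P f)
                \<le> ennreal (N / l) * mixed_norm p q half_space (\<lambda>z. ennreal (f z)))"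
proof
  fix B :: real
  let ?d = "real CARD('n)"
  \<comment> \<open>The powers of \<open>l\<close> in the potential bound and in the norm of the weight; they add up to \<open>- 1\<close>.\<close>
  define e1 where "e1 = - nu d0 p q + (?d - 2 * d0) / 2 * rcp p"
  define e2 where "e2 = - (?d / 2 * rcp p) - rcp q"
  have "?d / 2 < d0"
    using d0 by (simp add: d0_constant_def Let_def)
  then have d0_pos: "0 < d0"
    by (rule le_less_trans[rotated]) simp
  have xi: "0 < xi \<delta>"
    using constants delta by (simp add: exit_constants_def)
  obtain N where N: "0 < N" and potential_bound:
    "\<And>h bbar (M :: 'n trajectory measure) (x :: real \<Rightarrow> 'n trajectory \<Rightarrow> real^'n) l f.
       diffusion_type \<delta> p0 q0 h bbar M x \<Longrightarrow> Nbar p0 \<delta> * bbar Rlow < 1 \<Longrightarrow> (bbar \<longlongrightarrow> B) at_top \<Longrightarrow>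
       0 < l \<Longrightarrow> nonneg_borel f \<Longrightarrow>
       potential l M x f \<le> ennreal (N * lam_ddot ?d d0 l powr e1) *
         mixed_norm p q half_space (\<lambda>z. ennreal (Psi (xi \<delta>) Rlow l z powr (1 - nu d0 p q) * f z))"
    using d0_constant_potential_bound[OF d0 pq, of B] unfolding e1_def by blast
  obtain K where K: "0 < K" and weight: "\<And>l. 1 \<le> l \<Longrightarrow> mixed_norm p q half_space
      (\<lambda>z :: 'n spacetime. ennreal (Psi (xi \<delta>) Rlow l z powr (1 - nu d0 p q))) \<le> ennreal (K * l powr e2)"
    using mixed_norm_Psi[OF pq(1,2) d0_pos Rlow xi, where 'n = 'n] unfolding e2_def by blast
  show "\<exists>N>0. \<forall>h bbar (\<sigma> :: 'n spacetime \<Rightarrow> real^'n^'n) (b :: 'n spacetime \<Rightarrow> real^'n) P.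
      drift_bound p0 q0 h bbar \<and> Nbar p0 \<delta> * bbar Rlow < 1 \<and> (bbar \<longlongrightarrow> B) at_top \<and>
      \<sigma> \<in> borel_measurable borel \<and> (\<forall>z. \<sigma> z \<in> S_delta \<delta>) \<and>
      b \<in> borel_measurable borel \<and> (\<forall>z. norm (b z) \<le> h z) \<and> markov_diffusion \<sigma> b P \<longrightarrow>
      (\<forall>l\<ge>1. \<forall>f. nonneg_borel f \<longrightarrow>
         mixed_norm p q half_space (resolvent l P f)
         \<le> ennreal (N / l) * mixed_norm p q half_space (\<lambda>z. ennreal (f z)))"
  proof (intro exI[of _ "N * K"] conjI allI impI; (elim conjE)?)
    show "0 < N * K" using N K by simp
  next
    fix h :: "'n spacetime \<Rightarrow> real" and bbar and \<sigma> :: "'n spacetime \<Rightarrow> real^'n^'n"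
      and b :: "'n spacetime \<Rightarrow> real^'n" and P and l :: real and f :: "'n spacetime \<Rightarrow> real"
    assume h: "drift_bound p0 q0 h bbar" "Nbar p0 \<delta> * bbar Rlow < 1" "(bbar \<longlongrightarrow> B) at_top"
      and \<sigma>: "\<forall>z. \<sigma> z \<in> S_delta \<delta>" and b: "\<forall>z. norm (b z) \<le> h z"
      and P: "markov_diffusion \<sigma> b P" and l: "1 \<le> l" and f: "nonneg_borel f"
    have f_meas[measurable]: "f \<in> borel_measurable borel" and f_nonneg: "\<And>z. 0 \<le> f z"
      using f by (auto simp: nonneg_borel_def)
    let ?W = "\<lambda>z :: 'n spacetime. ennreal (Psi (xi \<delta>) Rlow l z powr (1 - nu d0 p q))"
    have ddot: "lam_ddot ?d d0 l = l"
      using l by (simp add: lam_ddot_def)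
    have "resolvent l P f z \<le> ennreal (N * l powr e1) *
        mixed_norm p q half_space (\<lambda>y. ?W y * ennreal (f (z + y)))" for z
    proof -
      have "nonneg_borel (\<lambda>y. f (z + y))"
        by (simp add: nonneg_borel_def f_nonneg)
      then show ?thesis
        using potential_bound[OF markov_diffusion_diffusion_type[OF P h(1)] h(2,3), of l "\<lambda>y. f (z + y)" z] \<sigma> b l
        by (simp add: resolvent_eq_potential ddot ennreal_mult')
    qed
    moreover have "resolvent l P f \<in> borel_measurable borel"
    proof (rule measurable_resolvent[OF _ f markov_diffusion_clock[OF P]])
      show "markov_process Nfil P"
        using P unfolding markov_diffusion_def strong_markov_process_def by blast
    qed
    moreover have "?W \<in> borel_measurable borel"
      unfolding Psi_def borel_prod[symmetric] by measurable
    ultimately have "mixed_norm p q half_space (resolvent l P f)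
        \<le> ennreal (N * l powr e1) * (mixed_norm p q half_space ?W * mixed_norm p q half_space (\<lambda>z. ennreal (f z)))"
      by (intro mixed_norm_convolution pq) auto
    also have "\<dots> \<le> ennreal (N * l powr e1) * (ennreal (K * l powr e2) * mixed_norm p q half_space (\<lambda>z. ennreal (f z)))"
      by (intro mult_left_mono mult_right_mono weight l) auto
    also have "\<dots> = ennreal ((N * l powr e1) * (K * l powr e2)) * mixed_norm p q half_space (\<lambda>z. ennreal (f z))"
      using N K by (simp add: ennreal_mult mult.assoc)
    also have "(N * l powr e1) * (K * l powr e2) = N * K * l powr (e1 + e2)"
      by (simp add: powr_add)
    also have "e1 + e2 = - 1"
      by (simp add: e1_def e2_def nu_def field_simps)
    also have "N * K * l powr - 1 = N * K / l"
      using l by (simp add: powr_minus divide_inverse)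
    finally show "mixed_norm p q half_space (resolvent l P f)
        \<le> ennreal (N * K / l) * mixed_norm p q half_space (\<lambda>z. ennreal (f z))" .
  qed
qed

end
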